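(* Let $1\le p\le n$, let $A_1,\dots,A_N$ be real symmetric $n\times n$ matrices, and let $f(Y)=-\sum_{l=1}^N\|\operatorname{diag}(Y^TA_lY)\|_F^2$ on $\mathrm{St}(p,n)$, endowed with the canonical metric $g_Y(\xi,\eta)=\operatorname{tr}\bigl(\xi^T(I_n-\tfrac12YY^T)\eta\bigr)$; let $\operatorname{Hess}^{\mathrm c}f$ be the Riemannian Hessian of $f$ with respect to $g$. Let $Y\in\mathrm{St}(p,n)$ and let $Y_\perp\in\mathbb R^{n\times(n-p)}$ satisfy $Y^TY_\perp=0$ and $Y_\perp^TY_\perp=I_{n-p}$. Put $Z_l=Y^TA_lY$, $Z_l^{\perp}=Y^TA_lY_\perp$, $Z_l^{\perp\perp}=Y_\perp^TA_lY_\perp$. For $\xi=YB+Y_\perp C$ with $B\in\mathrm{Skew}(p)$, $C\in\mathbb R^{(n-p)\times p}$, write $\operatorname{Hess}^{\mathrm c}f(Y)[\xi]=YB_H^{\mathrm c}+Y_\perp C_H^{\mathrm c}$ with $B_H^{\mathrm c}\in\mathrm{Skew}(p)$, $C_H^{\mathrm c}\in\mathbb R^{(n-p)\times p}$. Then $$\begin{pmatrix}\operatorname{veck}(B_H^{\mathrm c})\\ \operatorname{vec}(C_H^{\mathrm c})\end{pmatrix}=H_A^{\mathrm c}\begin{pmatrix}\operatorname{veck}(B)\\ \operatorname{vec}(C)\end{pmatrix},\qquad H_A^{\mathrm c}=\begin{pmatrix}H_{11}^{\mathrm c}&H_{12}^{\mathrm c}\\H_{21}^{\mathrm c}&H_{22}^{\mathrm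 c}\end{pmatrix},$$ where $$H_{11}^{\mathrm c}=-4D_p^T\sum_{l=1}^N\Bigl(\operatorname{diag}(Z_l)\otimes Z_l+2(I_p\otimes Z_l)\Delta_p(I_p\otimes Z_l)-\operatorname{sym}(Z_l\operatorname{diag}(Z_l))\otimes I_p\Bigr)D_p,$$ $$H_{12}^{\mathrm c}=-4D_p^T\sum_{l=1}^N\Bigl(\operatorname{diag}(Z_l)\otimes Z_l^{\perp}+2(I_p\otimes Z_l)\Delta_p(I_p\otimes Z_l^{\perp})-\tfrac12 I_p\otimes(\operatorname{diag}(Z_l)Z_l^{\perp})\Bigr),$$ $$H_{21}^{\mathrm c}=-4\sum_{l=1}^N\Bigl(\operatorname{diag}(Z_l)\otimes (Z_l^{\perp})^T+2(I_p\otimes (Z_l^{\perp})^T)\Delta_p(I_p\otimes Z_l)-\tfrac12 I_p\otimes((Z_l^{\perp})^T\operatorname{diag}(Z_l))\Bigr)D_p,$$ $$H_{22}^{\mathrm c}=-4\sum_{l=1}^N\Bigl(\operatorname{diag}(Z_l)\otimes Z_l^{\perp\perp}+2(I_p\otimes (Z_l^{\perp})^T)\Delta_p(I_p\otimes Z_l^{\perp})-\operatorname{sym}(Z_l\operatorname{diag}(Z_l))\otimes I_{n-p}\Bigr).$$ Moreover $H_A^{\mathrm c}$ is symmetric, i.e. $(H_{11}^{\mathrm c})^T=H_{11}^{\mathrm c}$, $(H_{12}^{\mathrm c})^T=H_{21}^{\mathrm c}$, $(H_{22}^{\mathrm c})^T=H_{22}^{\mathrm c}$.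
   Context: $\mathrm{St}(p,n)=\{Y\in\mathbb R^{n\times p}: Y^TY=I_p\}$, with tangent space $T_Y\mathrm{St}(p,n)=\{\xi\in\mathbb R^{n\times p}:\xi^TY+Y^T\xi=0\}=\{YB+Y_\perp C: B\in\mathrm{Skew}(p),\ C\in\mathbb R^{(n-p)\times p}\}$, where $\mathrm{Skew}(p)$ is the set of real skew-symmetric $p\times p$ matrices. Let $\bar f$ be the function on $\mathbb R^{n\times p}$ given by the same formula as $f$, with Euclidean gradient $\operatorname{grad}\bar f(Y)=-4\sum_lA_lY\operatorname{diag}(Y^TA_lY)$ and derivative of the gradient $\mathrm D(\operatorname{grad}\bar f)(Y)[\xi]=-4\sum_l(A_l\xi\operatorname{diag}(Y^TA_lY)+2A_lY\operatorname{diag}(Y^TA_l\xi))$. The Hessian with respect to the canonical metric is the linear operator on $T_Y\mathrm{St}(p,n)$ determined by the following known formula (Edelman–Arias–Smith): $g_Y(\operatorname{Hess}^{\mathrm c}f(Y)[\xi],\eta)=\operatorname{tr}(G_Y(\xi)^T\eta)$ for all $\xi,\eta\in T_Y\mathrm{St}(p,n)$, where $$G_Y(\xi)=\mathrm D(\operatorname{grad}\bar f)(Y)[\xi]+\tfrac12\Bigl(Y\xi^T\operatorname{grad}\bar f(Y)+\operatorname{grad}\bar f(Y)\,\xi^TY-(I_n-YY^T)\xi\bigl(Y^T\operatorname{grad}\bar f(Y)+\operatorname{grad}\bar f(Y)^TY\bigr)\Bigr).$$ For a square matrix $W=(w_{ij})$: $\operatorname{sym}(W)=(W+W^T)/2$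 and $\operatorname{diag}(W)$ is the diagonal matrix with the same diagonal as $W$. $\|\cdot\|_F$ is the Frobenius norm and $\otimes$ is the Kronecker product. $\operatorname{vec}(W)$ stacks the columns of $W$ vertically. For a skew-symmetric $m\times m$ matrix $S=(s_{ij})$, $\operatorname{veck}(S)=(s_{21},\dots,s_{m1},s_{32},\dots,s_{m2},\dots,s_{m,m-1})^T\in\mathbb R^{m(m-1)/2}$. $E^{(a\times b)}_{ij}$ is the $a\times b$ matrix with $(i,j)$ entry $1$ and all other entries $0$. $\Delta_m=\sum_{i=1}^m E^{(m\times m)}_{ii}\otimes E^{(m\times m)}_{ii}$. $D_m$ is the $m^2\times m(m-1)/2$ matrix $$D_m=\sum_{m\ge i>j\ge1}\Bigl(E^{(m^2\times m(m-1)/2)}_{m(j-1)+i,\ j(m-(j+1)/2)-m+i}-E^{(m^2\times m(m-1)/2)}_{m(i-1)+j,\ j(m-(j+1)/2)-m+i}\Bigr),$$ so that $\operatorname{vec}(S)=D_m\operatorname{veck}(S)$ for every skew-symmetric $m\times m$ matrix $S$. If $p=n$, $Y_\perp$ and $C$ are empty and only the block $H_{11}^{\mathrm c}$ is present. *)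

theory Defs
  imports "HOL-Analysis.Derivative" "Jordan_Normal_Form.Matrix"
begin

hide_const (open) Finite_Cartesian_Product.vec Finite_Cartesian_Product.mat

section \<open>Matrix operations\<close>

text \<open>Matrix entries are indexed from 0 by the library.\<close>

definition mat_sum :: "nat \<Rightarrow> nat \<Rightarrow> ('i \<Rightarrow> real mat) \<Rightarrow> 'i set \<Rightarrow> real mat" where
  "mat_sum r c M I = mat r c (\<lambda>ij. \<Sum>l\<in>I. M l $$ ij)"

definition kron :: "real mat \<Rightarrow> real mat \<Rightarrow> real mat" (infixl "\<otimes>\<^sub>K" 72) where
  "A \<otimes>\<^sub>K B = mat (dim_row A * dim_row B) (dim_col A * dim_col B)
     (\<lambda>(i, j). A $$ (i div dim_row B, j div dim_col B) * B $$ (i mod dim_row B, j mod dim_col B))"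

definition trace_mat :: "real mat \<Rightarrow> real" where
  "trace_mat W = (\<Sum>i<dim_row W. W $$ (i, i))"

definition frob_norm :: "real mat \<Rightarrow> real" where
  "frob_norm W = sqrt (\<Sum>i<dim_row W. \<Sum>j<dim_col W. (W $$ (i, j))\<^sup>2)"

definition sym_part :: "real mat \<Rightarrow> real mat" where
  "sym_part W = (1/2) \<cdot>\<^sub>m (W + W\<^sup>T)"

definition diag_part :: "real mat \<Rightarrow> real mat" where
  "diag_part W = mat_diag (dim_row W) (\<lambda>i. W $$ (i, i))"

definition skew_mats :: "nat \<Rightarrow> real mat set" where
  "skew_mats m = {S \<in> carrier_mat m m. S\<^sup>T = - S}"

definition vec_cols :: "real mat \<Rightarrow> real vec" where
  "vec_cols W = vec (dim_row W * dim_col W) (\<lambda>k. W $$ (k mod dim_row W, k div dim_row W))"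

definition veck :: "real mat \<Rightarrow> real vec" where
  "veck S = vec_of_list
     (concat (map (\<lambda>j. map (\<lambda>i. S $$ (i, j)) [j + 1..<dim_row S]) [0..<dim_row S]))"

text \<open>In \<open>unit_mat\<close> the position \<open>i, j\<close> of the nonzero entry is counted from 1, as in
  \<open>E\<^sub>i\<^sub>j\<close>.\<close>

definition unit_mat :: "nat \<Rightarrow> nat \<Rightarrow> nat \<Rightarrow> nat \<Rightarrow> real mat" where
  "unit_mat a b i j = mat a b (\<lambda>(r, c). if r + 1 = i \<and> c + 1 = j then 1 else 0)"

definition Delta_mat :: "nat \<Rightarrow> real mat" where
  "Delta_mat m = mat_sum (m * m) (m * m) (\<lambda>i. unit_mat m m i i \<otimes>\<^sub>K unit_mat m m i i) {1..m}"

text \<open>The column index \<open>j (m - (j + 1) / 2) - m + i\<close>, rearranged so that for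
  \<open>1 \<le> j < i \<le> m\<close> neither the subtraction nor the division on \<open>nat\<close> truncates.\<close>

definition veck_index :: "nat \<Rightarrow> nat \<Rightarrow> nat \<Rightarrow> nat" where
  "veck_index m i j = (j * m + i) - (m + j * (j + 1) div 2)"

definition D_mat :: "nat \<Rightarrow> real mat" where
  "D_mat m = (let q = m * (m - 1) div 2 in
     mat_sum (m * m) q
       (\<lambda>(i, j). unit_mat (m * m) q (m * (j - 1) + i) (veck_index m i j)
               - unit_mat (m * m) q (m * (i - 1) + j) (veck_index m i j))
       {(i, j). 1 \<le> j \<and> j < i \<and> i \<le> m})"

section \<open>The Stiefel manifold with the canonical metric\<close>

definition stiefel :: "nat \<Rightarrow> nat \<Rightarrow> real mat set" where
  "stiefel p n = {Y \<in> carrier_mat n p. Y\<^sup>T * Y = 1\<^sub>m p}"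

definition stiefel_tangent :: "nat \<Rightarrow> nat \<Rightarrow> real mat \<Rightarrow> real mat set" where
  "stiefel_tangent p n Y = {\<xi> \<in> carrier_mat n p. \<xi>\<^sup>T * Y + Y\<^sup>T * \<xi> = 0\<^sub>m p p}"

definition canonical_metric :: "nat \<Rightarrow> real mat \<Rightarrow> real mat \<Rightarrow> real mat \<Rightarrow> real" where
  "canonical_metric n Y \<xi> \<eta> = trace_mat (\<xi>\<^sup>T * (1\<^sub>m n - (1/2) \<cdot>\<^sub>m (Y * Y\<^sup>T)) * \<eta>)"

text \<open>Matrix of partial derivatives of a function on \<open>n \<times> p\<close> matrices.\<close>

definition euclid_grad :: "nat \<Rightarrow> nat \<Rightarrow> (real mat \<Rightarrow> real) \<Rightarrow> real mat \<Rightarrow> real mat" where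
  "euclid_grad p n F X =
     mat n p (\<lambda>(i, j). deriv (\<lambda>t. F (X + t \<cdot>\<^sub>m unit_mat n p (i + 1) (j + 1))) 0)"

text \<open>Entrywise derivative of a matrix-valued map at \<open>X\<close> in direction \<open>\<xi>\<close>.\<close>

definition dir_deriv ::
    "nat \<Rightarrow> nat \<Rightarrow> (real mat \<Rightarrow> real mat) \<Rightarrow> real mat \<Rightarrow> real mat \<Rightarrow> real mat" where
  "dir_deriv p n \<Phi> X \<xi> = mat n p (\<lambda>(i, j). deriv (\<lambda>t. \<Phi> (X + t \<cdot>\<^sub>m \<xi>) $$ (i, j)) 0)"

text \<open>Edelman--Arias--Smith formula for the Hessian with respect to the canonical metric, for
  the restriction to the Stiefel manifold of a function \<open>F\<close> on all \<open>n \<times> p\<close> matrices.\<close>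

definition hess_form :: "nat \<Rightarrow> nat \<Rightarrow> (real mat \<Rightarrow> real) \<Rightarrow> real mat \<Rightarrow> real mat \<Rightarrow> real mat" where
  "hess_form p n F Y \<xi> = (let g = euclid_grad p n F Y in
     dir_deriv p n (euclid_grad p n F) Y \<xi>
     + (1/2) \<cdot>\<^sub>m (Y * \<xi>\<^sup>T * g + g * \<xi>\<^sup>T * Y
                 - (1\<^sub>m n - Y * Y\<^sup>T) * \<xi> * (Y\<^sup>T * g + g\<^sup>T * Y)))"

definition canonical_hess ::
    "nat \<Rightarrow> nat \<Rightarrow> (real mat \<Rightarrow> real) \<Rightarrow> real mat \<Rightarrow> real mat \<Rightarrow> real mat" where
  "canonical_hess p n F Y \<xi> = (THE \<zeta>. \<zeta> \<in> stiefel_tangent p n Y \<and>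
     (\<forall>\<eta>\<in>stiefel_tangent p n Y.
        canonical_metric n Y \<zeta> \<eta> = trace_mat ((hess_form p n F Y \<xi>)\<^sup>T * \<eta>)))"

section \<open>The objective function and the matrix of its Hessian\<close>

definition objective :: "nat \<Rightarrow> (nat \<Rightarrow> real mat) \<Rightarrow> real mat \<Rightarrow> real" where
  "objective N A Y = - (\<Sum>l=1..N. (frob_norm (diag_part (Y\<^sup>T * A l * Y)))\<^sup>2)"

text \<open>Below \<open>q\<close> stands for \<open>n - p\<close>, and \<open>Z l\<close>, \<open>Zp l\<close>, \<open>Zpp l\<close> for
  \<open>Y\<^sup>T A\<^sub>l Y\<close>, \<open>Y\<^sup>T A\<^sub>l Y\<^sub>\<bottom>\<close>, \<open>Y\<^sub>\<bottom>\<^sup>T A\<^sub>l Y\<^sub>\<bottom>\<close>.\<close>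

definition H11 :: "nat \<Rightarrow> nat \<Rightarrow> (nat \<Rightarrow> real mat) \<Rightarrow> real mat" where
  "H11 p N Z = (-4) \<cdot>\<^sub>m ((D_mat p)\<^sup>T * mat_sum (p * p) (p * p) (\<lambda>l.
       diag_part (Z l) \<otimes>\<^sub>K Z l
     + 2 \<cdot>\<^sub>m ((1\<^sub>m p \<otimes>\<^sub>K Z l) * Delta_mat p * (1\<^sub>m p \<otimes>\<^sub>K Z l))
     - sym_part (Z l * diag_part (Z l)) \<otimes>\<^sub>K 1\<^sub>m p) {1..N} * D_mat p)"

definition H12 ::
    "nat \<Rightarrow> nat \<Rightarrow> nat \<Rightarrow> (nat \<Rightarrow> real mat) \<Rightarrow> (nat \<Rightarrow> real mat) \<Rightarrow> real mat" where
  "H12 p q N Z Zp = (-4) \<cdot>\<^sub>m ((D_mat p)\<^sup>T * mat_sum (p * p) (p * q) (\<lambda>l.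
       diag_part (Z l) \<otimes>\<^sub>K Zp l
     + 2 \<cdot>\<^sub>m ((1\<^sub>m p \<otimes>\<^sub>K Z l) * Delta_mat p * (1\<^sub>m p \<otimes>\<^sub>K Zp l))
     - (1/2) \<cdot>\<^sub>m (1\<^sub>m p \<otimes>\<^sub>K (diag_part (Z l) * Zp l))) {1..N})"

definition H21 ::
    "nat \<Rightarrow> nat \<Rightarrow> nat \<Rightarrow> (nat \<Rightarrow> real mat) \<Rightarrow> (nat \<Rightarrow> real mat) \<Rightarrow> real mat" where
  "H21 p q N Z Zp = (-4) \<cdot>\<^sub>m (mat_sum (p * q) (p * p) (\<lambda>l.
       diag_part (Z l) \<otimes>\<^sub>K (Zp l)\<^sup>T
     + 2 \<cdot>\<^sub>m ((1\<^sub>m p \<otimes>\<^sub>K (Zp l)\<^sup>T) * Delta_mat p * (1\<^sub>m p \<otimes>\<^sub>K Z l))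
     - (1/2) \<cdot>\<^sub>m (1\<^sub>m p \<otimes>\<^sub>K ((Zp l)\<^sup>T * diag_part (Z l)))) {1..N} * D_mat p)"

definition H22 ::
    "nat \<Rightarrow> nat \<Rightarrow> nat \<Rightarrow> (nat \<Rightarrow> real mat) \<Rightarrow> (nat \<Rightarrow> real mat) \<Rightarrow> (nat \<Rightarrow> real mat) \<Rightarrow> real mat" where
  "H22 p q N Z Zp Zpp = (-4) \<cdot>\<^sub>m mat_sum (p * q) (p * q) (\<lambda>l.
       diag_part (Z l) \<otimes>\<^sub>K Zpp l
     + 2 \<cdot>\<^sub>m ((1\<^sub>m p \<otimes>\<^sub>K (Zp l)\<^sup>T) * Delta_mat p * (1\<^sub>m p \<otimes>\<^sub>K Zp l))
     - sym_part (Z l * diag_part (Z l)) \<otimes>\<^sub>K 1\<^sub>m q) {1..N}"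

text \<open>For \<open>q = 0\<close> the off-diagonal and lower blocks are empty and this is \<open>H11\<close>.\<close>

definition H_mat ::
    "nat \<Rightarrow> nat \<Rightarrow> nat \<Rightarrow> (nat \<Rightarrow> real mat) \<Rightarrow> (nat \<Rightarrow> real mat) \<Rightarrow> (nat \<Rightarrow> real mat) \<Rightarrow> real mat" where
  "H_mat p q N Z Zp Zpp =
     four_block_mat (H11 p N Z) (H12 p q N Z Zp) (H21 p q N Z Zp) (H22 p q N Z Zp Zpp)"

end

theory Submission
  imports Defs "Jordan_Normal_Form.Determinant"
begin

text \<open>With \<open>W = Y\<^sup>T G\<close> for \<open>G = G\<^sub>Y(\<xi>)\<close>, testing the defining equation of the Hessian against
  \<open>\<eta> = Y E + Y\<^sub>\<bottom> F\<close> shows that its coordinates are \<open>B\<^sub>H = W - W\<^sup>T\<close> and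
  \<open>C\<^sub>H = Y\<^sub>\<bottom>\<^sup>T G\<close>; the factor 1/2 of the canonical metric on the \<open>E\<close>-part is what turns the
  skew part of \<open>W\<close> into \<open>W - W\<^sup>T\<close>. Since \<open>D\<^sub>p\<^sup>T vec(X) = veck(X - X\<^sup>T)\<close> for every square
  \<open>X\<close>, one may replace \<open>W\<close> by any matrix with the same skew part, which absorbs the asymmetric
  terms of \<open>G\<close> into those of the blocks. The rest is
  \<open>(A \<otimes> B) vec(X) = vec(B X A\<^sup>T)\<close> and \<open>\<Delta>\<^sub>p vec(X) = vec(diag(X))\<close>.\<close>

section \<open>Matrix algebra\<close>

text \<open>\<open>deriv\<close> and \<open>THE\<close> are total and return some value in every
  case. So the gradient must come from genuine derivatives, at every matrix X and not just on the
  manifold, because \<open>dir_deriv\<close> differentiates it along a line that leaves the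
  manifold; and the vector described by \<open>THE\<close> must be shown to exist and to be unique.
  Uniqueness is definiteness of the metric, which reads 1/2 tr(B^T E) + tr(C^T F) in coordinates.
  Every tangent vector has coordinates because Y Y^T + Yp Yp^T is the identity: a square matrix with
  orthonormal columns also has orthonormal rows. Write Z, Zp for one index l and d = diag(Z), and
  drop the factor -4. The terms of W that do not fit the blocks are -1/2 Z d B and 1/2 C^T Zp^T d.
  They have the same skew parts as -1/2 B d Z and -1/2 d Zp C. The first completes -1/2 B Z d to -B
  sym(Z d); the second yields the coefficient and the sign of the last term of \<open>H12\<close>.
  This choice of representative is also what makes the matrix between the two factors D in
  \<open>H11\<close> symmetric and \<open>H12\<close> the transpose of \<open>H21\<close>.\<close>

lemma mult_mat_assoc:
  fixes A B C :: "real mat"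
  assumes "dim_col A = dim_row B" "dim_col B = dim_row C"
  shows "A * B * C = A * (B * C)"
  by (rule assoc_mult_mat[of A "dim_row A" "dim_col A" B "dim_col B" C "dim_col C"])
     (use assms in auto)

lemma mult_mat_add:
  fixes A B C :: "real mat"
  assumes "dim_col A = dim_row B" "dim_row B = dim_row C" "dim_col B = dim_col C"
  shows "A * (B + C) = A * B + A * C"
  by (rule mult_add_distrib_mat[of A "dim_row A" "dim_col A" B "dim_col B" C])
     (use assms in auto)

lemma add_mult_mat:
  fixes A B C :: "real mat"
  assumes "dim_row A = dim_row B" "dim_col A = dim_col B" "dim_col B = dim_row C"
  shows "(A + B) * C = A * C + B * C"
  by (rule add_mult_distrib_mat[of A "dim_row A" "dim_col A" B C "dim_col C"])
     (use assms in auto)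

lemma mult_mat_minus:
  fixes A B C :: "real mat"
  assumes "dim_col A = dim_row B" "dim_row B = dim_row C" "dim_col B = dim_col C"
  shows "A * (B - C) = A * B - A * C"
  by (rule mult_minus_distrib_mat[of A "dim_row A" "dim_col A" B "dim_col B" C])
     (use assms in auto)

lemma minus_mult_mat:
  fixes A B C :: "real mat"
  assumes "dim_row A = dim_row B" "dim_col A = dim_col B" "dim_col B = dim_row C"
  shows "(A - B) * C = A * C - B * C"
  by (rule minus_mult_distrib_mat[of A "dim_row A" "dim_col A" B C "dim_col C"])
     (use assms in auto)

lemma mult_mat_smult:
  fixes A B :: "real mat"
  assumes "dim_col A = dim_row B"
  shows "A * (k \<cdot>\<^sub>m B) = k \<cdot>\<^sub>m (A * B)"
  by (rule mult_smult_distrib[of A "dim_row A" "dim_col A" B "dim_col B"]) (use assms in auto)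

lemma smult_mult_mat:
  fixes A B :: "real mat"
  assumes "dim_col A = dim_row B"
  shows "(k \<cdot>\<^sub>m A) * B = k \<cdot>\<^sub>m (A * B)"
  by (rule mult_smult_assoc_mat[of A "dim_row A" "dim_col A" B "dim_col B"]) (use assms in auto)

lemma transpose_mult_mat:
  fixes A B :: "real mat"
  assumes "dim_col A = dim_row B"
  shows "(A * B)\<^sup>T = B\<^sup>T * A\<^sup>T"
  by (rule transpose_mult[of A "dim_row A" "dim_col A" B "dim_col B"]) (use assms in auto)

lemma transpose_add_mat:
  fixes A B :: "real mat"
  assumes "dim_row A = dim_row B" "dim_col A = dim_col B"
  shows "(A + B)\<^sup>T = A\<^sup>T + B\<^sup>T"
  using assms by (intro eq_matI) auto

lemma transpose_minus_mat:
  fixes A B :: "real mat"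
  assumes "dim_row A = dim_row B" "dim_col A = dim_col B"
  shows "(A - B)\<^sup>T = A\<^sup>T - B\<^sup>T"
  using assms by (intro eq_matI) auto

lemma transpose_smult_mat: "(k \<cdot>\<^sub>m A)\<^sup>T = k \<cdot>\<^sub>m (A\<^sup>T :: real mat)"
  by (intro eq_matI) auto

lemma smult_add_mat:
  fixes A B :: "real mat"
  assumes "dim_row A = dim_row B" "dim_col A = dim_col B"
  shows "k \<cdot>\<^sub>m (A + B) = k \<cdot>\<^sub>m A + k \<cdot>\<^sub>m B"
  using assms by (intro eq_matI) (auto simp: algebra_simps)

lemma smult_minus_mat:
  fixes A B :: "real mat"
  assumes "dim_row A = dim_row B" "dim_col A = dim_col B"
  shows "k \<cdot>\<^sub>m (A - B) = k \<cdot>\<^sub>m A - k \<cdot>\<^sub>m B"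
  using assms by (intro eq_matI) (auto simp: algebra_simps)

lemma smult_smult_mat: "a \<cdot>\<^sub>m (b \<cdot>\<^sub>m A) = (a * b) \<cdot>\<^sub>m (A :: real mat)"
  by (intro eq_matI) auto

text \<open>A normal form for matrix expressions: sums are multiplied out, scalars move outward,
  transposes move to the factors, and products nest to the right. The premises are equations between
  dimensions, which the simplifier can discharge by itself.\<close>

lemmas mat_expand = mult_mat_assoc mult_mat_add add_mult_mat mult_mat_minus minus_mult_mat
  mult_mat_smult smult_mult_mat transpose_mult_mat transpose_add_mat transpose_minus_mat
  transpose_smult_mat

lemma mat_mult_vec_assoc:
  fixes A B :: "real mat"
  assumes "dim_col A = dim_row B" "dim_col B = dim_vec v"
  shows "A * B *\<^sub>v v = A *\<^sub>v (B *\<^sub>v v)"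
  by (rule assoc_mult_mat_vec[of A "dim_row A" "dim_col A" B "dim_col B" v])
     (use assms in \<open>auto intro: carrier_vecI\<close>)

section \<open>Entries of products, and traces\<close>

lemma index_mult_mat_sum:
  fixes A B :: "real mat"
  assumes "i < dim_row A" "j < dim_col B" "dim_col A = dim_row B"
  shows "(A * B) $$ (i, j) = (\<Sum>k<dim_row B. A $$ (i, k) * B $$ (k, j))"
  using assms by (auto simp: scalar_prod_def lessThan_atLeast0)

lemma index_mult_vec_sum:
  fixes A :: "real mat"
  assumes "i < dim_row A" "dim_col A = dim_vec v"
  shows "(A *\<^sub>v v) $ i = (\<Sum>k<dim_vec v. A $$ (i, k) * v $ k)"
  using assms by (auto simp: scalar_prod_def lessThan_atLeast0)

lemma trace_mat_add:
  assumes "dim_row A = dim_row B" "dim_col A = dim_col B" "dim_row B = dim_col B"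
  shows "trace_mat (A + B) = trace_mat A + trace_mat B"
  using assms by (simp add: trace_mat_def sum.distrib)

lemma trace_mat_minus:
  assumes "dim_row A = dim_row B" "dim_col A = dim_col B" "dim_row B = dim_col B"
  shows "trace_mat (A - B) = trace_mat A - trace_mat B"
  using assms by (simp add: trace_mat_def sum_subtractf)

lemma trace_mat_smult:
  assumes "dim_row A = dim_col A"
  shows "trace_mat (k \<cdot>\<^sub>m A) = k * trace_mat A"
  using assms by (simp add: trace_mat_def sum_distrib_left)

lemma trace_mat_transpose:
  assumes "dim_row A = dim_col A"
  shows "trace_mat (A\<^sup>T) = trace_mat A"
  using assms by (simp add: trace_mat_def)

lemma trace_mat_mult_comm:
  assumes "dim_col A = dim_row B" "dim_col B = dim_row A"
  shows "trace_mat (A * B) = trace_mat (B * A)"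
proof -
  have "trace_mat (A * B) = (\<Sum>i<dim_row A. \<Sum>k<dim_row B. A $$ (i, k) * B $$ (k, i))"
    unfolding trace_mat_def using assms by (auto intro!: sum.cong simp: index_mult_mat_sum simp del: index_mult_mat(1))
  also have "\<dots> = (\<Sum>k<dim_row B. \<Sum>i<dim_row A. B $$ (k, i) * A $$ (i, k))"
    by (subst sum.swap) (simp add: mult.commute)
  also have "\<dots> = trace_mat (B * A)"
    unfolding trace_mat_def using assms by (auto intro!: sum.cong simp: index_mult_mat_sum simp del: index_mult_mat(1))
  finally show ?thesis .
qed

lemma trace_mat_transpose_mult_self:
  "trace_mat (A\<^sup>T * A) = (\<Sum>j<dim_col A. \<Sum>i<dim_row A. (A $$ (i, j))\<^sup>2)"
  unfolding trace_mat_def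
  by (auto intro!: sum.cong simp: index_mult_mat_sum power2_eq_square simp del: index_mult_mat(1))

lemma trace_mat_transpose_mult_self_nonneg: "0 \<le> trace_mat (A\<^sup>T * A)"
  unfolding trace_mat_transpose_mult_self by (intro sum_nonneg) auto

text \<open>The trace is a sum of squares of all entries. This definiteness gives uniqueness of the
  vector that represents the Hessian.\<close>

lemma trace_mat_transpose_mult_self_eq_0:
  assumes "trace_mat (A\<^sup>T * A) = 0" "A \<in> carrier_mat r c"
  shows "A = 0\<^sub>m r c"
proof (rule eq_matI)
  fix i j assume "i < dim_row (0\<^sub>m r c :: real mat)" "j < dim_col (0\<^sub>m r c :: real mat)"
  then have ij: "i < r" "j < c" by simp_all
  have "(\<Sum>j<c. \<Sum>i<r. (A $$ (i, j))\<^sup>2) = 0"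
    using assms by (simp add: trace_mat_transpose_mult_self)
  then have "(\<Sum>i<r. (A $$ (i, j))\<^sup>2) = 0"
    using ij by (subst (asm) sum_nonneg_eq_0_iff) (auto intro: sum_nonneg)
  then have "(A $$ (i, j))\<^sup>2 = 0"
    using ij by (subst (asm) sum_nonneg_eq_0_iff) auto
  then show "A $$ (i, j) = 0\<^sub>m r c $$ (i, j)" using ij by simp
qed (use assms in auto)

section \<open>Finite sums of matrices of a fixed size\<close>

lemma mat_sum_carrier [simp]: "mat_sum r c M I \<in> carrier_mat r c"
  by (simp add: mat_sum_def)

lemma mat_sum_dim [simp]: "dim_row (mat_sum r c M I) = r" "dim_col (mat_sum r c M I) = c"
  by (simp_all add: mat_sum_def)

lemma index_mat_sum [simp]:
  "i < r \<Longrightarrow> j < c \<Longrightarrow> mat_sum r c M I $$ (i, j) = (\<Sum>l\<in>I. M l $$ (i, j))"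
  by (simp add: mat_sum_def)

lemma mat_sum_cong:
  assumes "\<And>l. l \<in> I \<Longrightarrow> M l = M' l"
  shows "mat_sum r c M I = mat_sum r c M' I"
  using assms by (simp add: mat_sum_def)

lemma mult_mat_sum:
  assumes "dim_col A = r" "\<And>l. l \<in> I \<Longrightarrow> M l \<in> carrier_mat r c"
  shows "A * mat_sum r c M I = mat_sum (dim_row A) c (\<lambda>l. A * M l) I"
proof (rule eq_matI)
  fix i j assume ij: "i < dim_row (mat_sum (dim_row A) c (\<lambda>l. A * M l) I)"
    "j < dim_col (mat_sum (dim_row A) c (\<lambda>l. A * M l) I)"
  then have "(A * mat_sum r c M I) $$ (i, j) = (\<Sum>k<r. \<Sum>l\<in>I. A $$ (i, k) * M l $$ (k, j))"
    using assms(1) by (simp add: index_mult_mat_sum sum_distrib_left del: index_mult_mat(1))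
  also have "\<dots> = (\<Sum>l\<in>I. (A * M l) $$ (i, j))"
    using ij assms(1) assms(2)[THEN carrier_matD(1)] assms(2)[THEN carrier_matD(2)]
    by (subst sum.swap) (simp add: index_mult_mat_sum del: index_mult_mat(1))
  finally show "(A * mat_sum r c M I) $$ (i, j)
      = mat_sum (dim_row A) c (\<lambda>l. A * M l) I $$ (i, j)" using ij by simp
qed auto

lemma mat_sum_mult:
  assumes "dim_row A = c" "\<And>l. l \<in> I \<Longrightarrow> M l \<in> carrier_mat r c"
  shows "mat_sum r c M I * A = mat_sum r (dim_col A) (\<lambda>l. M l * A) I"
proof (rule eq_matI)
  fix i j assume ij: "i < dim_row (mat_sum r (dim_col A) (\<lambda>l. M l * A) I)"
    "j < dim_col (mat_sum r (dim_col A) (\<lambda>l. M l * A) I)"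
  then have "(mat_sum r c M I * A) $$ (i, j) = (\<Sum>k<c. \<Sum>l\<in>I. M l $$ (i, k) * A $$ (k, j))"
    using assms(1) by (simp add: index_mult_mat_sum sum_distrib_right del: index_mult_mat(1))
  also have "\<dots> = (\<Sum>l\<in>I. (M l * A) $$ (i, j))"
    using ij assms(1) assms(2)[THEN carrier_matD(1)] assms(2)[THEN carrier_matD(2)]
    by (subst sum.swap) (simp add: index_mult_mat_sum del: index_mult_mat(1))
  finally show "(mat_sum r c M I * A) $$ (i, j)
      = mat_sum r (dim_col A) (\<lambda>l. M l * A) I $$ (i, j)" using ij by simp
qed auto

lemma transpose_mat_sum:
  assumes "\<And>l. l \<in> I \<Longrightarrow> M l \<in> carrier_mat r c"
  shows "(mat_sum r c M I)\<^sup>T = mat_sum c r (\<lambda>l. (M l)\<^sup>T) I"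
  using assms[THEN carrier_matD(1)] assms[THEN carrier_matD(2)] by (intro eq_matI) auto

lemma mat_sum_add:
  assumes "\<And>l. l \<in> I \<Longrightarrow> M' l \<in> carrier_mat r c"
  shows "mat_sum r c M I + mat_sum r c M' I = mat_sum r c (\<lambda>l. M l + M' l) I"
  using assms[THEN carrier_matD(1)] assms[THEN carrier_matD(2)]
  by (intro eq_matI) (auto simp: sum.distrib)

lemma mat_sum_minus:
  assumes "\<And>l. l \<in> I \<Longrightarrow> M' l \<in> carrier_mat r c"
  shows "mat_sum r c M I - mat_sum r c M' I = mat_sum r c (\<lambda>l. M l - M' l) I"
  using assms[THEN carrier_matD(1)] assms[THEN carrier_matD(2)]
  by (intro eq_matI) (auto simp: sum_subtractf)

lemma smult_mat_sum:
  assumes "\<And>l. l \<in> I \<Longrightarrow> M l \<in> carrier_mat r c"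
  shows "k \<cdot>\<^sub>m mat_sum r c M I = mat_sum r c (\<lambda>l. k \<cdot>\<^sub>m M l) I"
  using assms[THEN carrier_matD(1)] assms[THEN carrier_matD(2)]
  by (intro eq_matI) (auto simp: sum_distrib_left)

section \<open>Column-major vectorization\<close>

lemma vec_cols_dim [simp]: "dim_vec (vec_cols X) = dim_row X * dim_col X"
  by (simp add: vec_cols_def)

lemma mod_div_less_mult:
  fixes k r c :: nat
  assumes "k < r * c"
  shows "k mod r < r" "k div r < c"
proof -
  show "k mod r < r" using assms by (intro mod_less_divisor gr0I) auto
  show "k div r < c" using assms by (simp add: less_mult_imp_div_less mult.commute)
qed

lemma index_vec_cols [simp]:
  "k < dim_row W * dim_col W \<Longrightarrow> vec_cols W $ k = W $$ (k mod dim_row W, k div dim_row W)"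
  by (simp add: vec_cols_def)

lemma vec_cols_add:
  assumes "dim_row A = dim_row B" "dim_col A = dim_col B"
  shows "vec_cols (A + B) = vec_cols A + vec_cols B"
  using assms by (intro eq_vecI) (auto simp: mod_div_less_mult)

lemma vec_cols_minus:
  assumes "dim_row A = dim_row B" "dim_col A = dim_col B"
  shows "vec_cols (A - B) = vec_cols A - vec_cols B"
  using assms by (intro eq_vecI) (auto simp: mod_div_less_mult)

lemma vec_cols_smult: "vec_cols (k \<cdot>\<^sub>m A) = k \<cdot>\<^sub>v vec_cols A"
  by (intro eq_vecI) (auto simp: mod_div_less_mult)

text \<open>Reduces each block to a single summand. The sizes \<open>R\<close> and \<open>D\<close>
  enter through equations because the blocks are indexed by \<open>p * q\<close> while
  \<open>vec_cols\<close> of a q x p matrix has length \<open>q * p\<close>.\<close>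

lemma mat_sum_mult_vec_cols:
  assumes R: "R = r * c" and D: "D = dim_row X * dim_col X"
    and M: "\<And>l. l \<in> I \<Longrightarrow> M l \<in> carrier_mat R D"
    and K: "\<And>l. l \<in> I \<Longrightarrow> K l \<in> carrier_mat r c"
    and MK: "\<And>l. l \<in> I \<Longrightarrow> M l *\<^sub>v vec_cols X = vec_cols (K l)"
  shows "mat_sum R D M I *\<^sub>v vec_cols X = vec_cols (mat_sum r c K I)"
proof (rule eq_vecI)
  fix i assume "i < dim_vec (vec_cols (mat_sum r c K I))"
  then have i: "i < r * c" by simp
  then have "(mat_sum R D M I *\<^sub>v vec_cols X) $ i
      = (\<Sum>k<D. \<Sum>l\<in>I. M l $$ (i, k) * vec_cols X $ k)"
    by (simp add: index_mult_vec_sum sum_distrib_right R D del: index_mult_mat_vec)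
  also have "\<dots> = (\<Sum>l\<in>I. \<Sum>k<D. M l $$ (i, k) * vec_cols X $ k)"
    by (rule sum.swap)
  also have "\<dots> = (\<Sum>l\<in>I. (M l *\<^sub>v vec_cols X) $ i)"
    using i M[THEN carrier_matD(1)] M[THEN carrier_matD(2)]
    by (intro sum.cong refl, subst index_mult_vec_sum) (auto simp: R D)
  also have "\<dots> = (\<Sum>l\<in>I. K l $$ (i mod r, i div r))"
    using i MK K[THEN carrier_matD(1)] K[THEN carrier_matD(2)]
    by (intro sum.cong refl) auto
  also have "\<dots> = vec_cols (mat_sum r c K I) $ i"
    using i by (simp add: mod_div_less_mult)
  finally show "(mat_sum R D M I *\<^sub>v vec_cols X) $ i = vec_cols (mat_sum r c K I) $ i" .
qed (simp add: R)

section \<open>Kronecker products\<close>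

lemma kron_dim [simp]:
  "dim_row (A \<otimes>\<^sub>K B) = dim_row A * dim_row B" "dim_col (A \<otimes>\<^sub>K B) = dim_col A * dim_col B"
  by (simp_all add: kron_def)

lemma index_kron:
  "i < dim_row A * dim_row B \<Longrightarrow> j < dim_col A * dim_col B \<Longrightarrow> (A \<otimes>\<^sub>K B) $$ (i, j) =
     A $$ (i div dim_row B, j div dim_col B) * B $$ (i mod dim_row B, j mod dim_col B)"
  by (simp add: kron_def)

lemma transpose_kron: "(A \<otimes>\<^sub>K B)\<^sup>T = A\<^sup>T \<otimes>\<^sub>K B\<^sup>T"
  by (intro eq_matI) (auto simp: index_kron mod_div_less_mult mult.commute[of "dim_row A"]
      mult.commute[of "dim_col A"])

text \<open>Euclidean division k = j * b + i cuts the range into a consecutive groups of length b.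
  It turns a sum over the column index of a Kronecker product into a double sum.\<close>

lemma sum_lessThan_mult:
  fixes f :: "nat \<Rightarrow> nat \<Rightarrow> 'a::comm_monoid_add"
  shows "(\<Sum>k<a * b. f (k div b) (k mod b)) = (\<Sum>j<a. \<Sum>i<b. f j i)"
proof -
  have "(\<Sum>k<a * b. f (k div b) (k mod b)) = (\<Sum>j<a. \<Sum>k = j * b..<j * b + b. f (k div b) (k mod b))"
    by (rule sum.nat_group[symmetric])
  also have "\<dots> = (\<Sum>j<a. \<Sum>i<b. f j i)"
  proof (rule sum.cong[OF refl])
    fix j
    have "(\<Sum>k = j * b..<j * b + b. f (k div b) (k mod b))
        = (\<Sum>i = 0..<b. f ((i + j * b) div b) ((i + j * b) mod b))"
      using sum.shift_bounds_nat_ivl[of "\<lambda>k. f (k div b) (k mod b)" 0 "j * b" b]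
      by (simp add: add.commute)
    also have "\<dots> = (\<Sum>i<b. f j i)"
      unfolding lessThan_atLeast0 by (rule sum.cong) auto
    finally show "(\<Sum>k = j * b..<j * b + b. f (k div b) (k mod b)) = (\<Sum>i<b. f j i)" .
  qed
  finally show ?thesis .
qed

text \<open>In column-major order the quotient of a position is a column and the remainder a row. In
  \<open>A \<otimes>\<^sub>K B\<close> the quotient selects the entry of \<open>A\<close> and the
  remainder that of \<open>B\<close>; hence \<open>B\<close> acts on the rows of \<open>X\<close>,
  and \<open>A\<close>, transposed, on its columns.\<close>

lemma kron_mult_vec_cols:
  assumes "dim_row X = dim_col B" "dim_col X = dim_col A"
  shows "(A \<otimes>\<^sub>K B) *\<^sub>v vec_cols X = vec_cols (B * X * A\<^sup>T)"
proof (rule eq_vecI)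
  fix k assume "k < dim_vec (vec_cols (B * X * A\<^sup>T))"
  then have k: "k < dim_row B * dim_row A" by simp
  let ?a = "k div dim_row B" and ?b = "k mod dim_row B"
  have ab: "?a < dim_row A" "?b < dim_row B" using k by (simp_all add: mod_div_less_mult)
  have "((A \<otimes>\<^sub>K B) *\<^sub>v vec_cols X) $ k
      = (\<Sum>c<dim_col A * dim_col B. A $$ (?a, c div dim_col B) * B $$ (?b, c mod dim_col B)
           * X $$ (c mod dim_col B, c div dim_col B))"
    using k assms by (subst index_mult_vec_sum) (auto simp: index_kron mult.commute intro!: sum.cong)
  also have "\<dots> = (\<Sum>j<dim_col A. \<Sum>i<dim_col B. A $$ (?a, j) * B $$ (?b, i) * X $$ (i, j))"
    by (rule sum_lessThan_mult)
  also have "\<dots> = (B * X * A\<^sup>T) $$ (?b, ?a)"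
    using ab assms by (simp add: index_mult_mat_sum sum_distrib_left sum_distrib_right ac_simps
        del: index_mult_mat(1))
  also have "\<dots> = vec_cols (B * X * A\<^sup>T) $ k" using k by simp
  finally show "((A \<otimes>\<^sub>K B) *\<^sub>v vec_cols X) $ k = vec_cols (B * X * A\<^sup>T) $ k" .
qed simp

section \<open>Diagonal parts, unit matrices and the matrix Delta\<close>

lemma diag_part_dim [simp]:
  "dim_row (diag_part W) = dim_row W" "dim_col (diag_part W) = dim_row W"
  by (simp_all add: diag_part_def mat_diag_def)

lemma index_diag_part [simp]:
  "i < dim_row W \<Longrightarrow> j < dim_row W \<Longrightarrow> diag_part W $$ (i, j) = (if i = j then W $$ (i, i) else 0)"
  by (simp add: diag_part_def mat_diag_def)

lemma transpose_diag_part: "(diag_part W)\<^sup>T = diag_part W"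
  by (intro eq_matI) auto

lemma diag_part_add:
  assumes "dim_row A = dim_row B" "dim_col A = dim_col B" "dim_row B = dim_col B"
  shows "diag_part (A + B) = diag_part A + diag_part B"
  using assms by (intro eq_matI) auto

lemma index_mult_diag_part:
  assumes "i < dim_row A" "j < dim_row W" "dim_col A = dim_row W"
  shows "(A * diag_part W) $$ (i, j) = A $$ (i, j) * W $$ (j, j)"
proof -
  have "(A * diag_part W) $$ (i, j) = (\<Sum>k<dim_row W. A $$ (i, k) * diag_part W $$ (k, j))"
    using assms by (subst index_mult_mat_sum) simp_all
  also have "\<dots> = (\<Sum>k<dim_row W. if k = j then A $$ (i, j) * W $$ (j, j) else 0)"
    using assms by (intro sum.cong) auto
  finally have "(A * diag_part W) $$ (i, j) = \<dots>" .
  then show ?thesis using assms by simp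
qed

lemma unit_mat_dim [simp]: "dim_row (unit_mat a b i j) = a" "dim_col (unit_mat a b i j) = b"
  by (simp_all add: unit_mat_def)

lemma index_unit_mat [simp]:
  "r < a \<Longrightarrow> c < b \<Longrightarrow> unit_mat a b i j $$ (r, c) = (if r + 1 = i \<and> c + 1 = j then 1 else 0)"
  by (simp add: unit_mat_def)

lemma Delta_mat_dim [simp]: "dim_row (Delta_mat m) = m * m" "dim_col (Delta_mat m) = m * m"
  by (simp_all add: Delta_mat_def)

lemma transpose_unit_mat: "(unit_mat a b i j)\<^sup>T = unit_mat b a j i"
  by (intro eq_matI) auto

lemma transpose_Delta_mat: "(Delta_mat m)\<^sup>T = Delta_mat m"
  unfolding Delta_mat_def
  by (subst transpose_mat_sum) (auto simp: transpose_kron transpose_unit_mat intro!: carrier_matI)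

text \<open>The summand of index i sends vec(X) to vec(E_ii X E_ii), and E_ii X E_ii retains nothing
  of X but its i-th diagonal entry.\<close>

lemma Delta_mult_vec_cols:
  assumes "X \<in> carrier_mat m m"
  shows "Delta_mat m *\<^sub>v vec_cols X = vec_cols (diag_part X)"
proof -
  have dX: "dim_row X = m" "dim_col X = m" using assms by auto
  let ?E = "\<lambda>i. unit_mat m m i i"
  have "Delta_mat m *\<^sub>v vec_cols X = vec_cols (mat_sum m m (\<lambda>i. ?E i * X * ?E i) {1..m})"
    unfolding Delta_mat_def
    by (rule mat_sum_mult_vec_cols)
       (auto simp: kron_mult_vec_cols transpose_unit_mat dX intro!: carrier_matI)
  also have "mat_sum m m (\<lambda>i. ?E i * X * ?E i) {1..m} = diag_part X"
  proof (rule eq_matI)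
    fix a b assume "a < dim_row (diag_part X)" "b < dim_col (diag_part X)"
    then have ab: "a < m" "b < m" using dX by auto
    \<comment> \<open>\<open>unit_mat\<close> counts positions from 1 and entries are indexed from
      0, so row a meets the nonzero entry of \<open>?E i\<close> exactly when a + 1 = i.\<close>
    have EX: "(?E i * X) $$ (a, k) = (if a + 1 = i then X $$ (a, k) else 0)" if "k < m" for i k
    proof -
      have "(?E i * X) $$ (a, k) = (\<Sum>q<m. ?E i $$ (a, q) * X $$ (q, k))"
        using ab that dX by (subst index_mult_mat_sum) simp_all
      also have "\<dots> = (\<Sum>q<m. if q = a then (if a + 1 = i then X $$ (a, k) else 0) else 0)"
        using ab by (intro sum.cong) auto
      finally have "(?E i * X) $$ (a, k) = \<dots>" .
      then show ?thesis using ab by simp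
    qed
    have "(?E i * X * ?E i) $$ (a, b) = (if i = a + 1 then (if a = b then X $$ (a, a) else 0) else 0)" for i
    proof -
      have "(?E i * X * ?E i) $$ (a, b) = (\<Sum>k<m. (?E i * X) $$ (a, k) * ?E i $$ (k, b))"
        using ab dX by (subst index_mult_mat_sum) simp_all
      also have "\<dots> = (\<Sum>k<m. if k = b then
         (if a + 1 = i \<and> b + 1 = i then X $$ (a, b) else 0) else 0)"
        using ab by (intro sum.cong) (auto simp: EX simp del: index_mult_mat(1))
      finally have "(?E i * X * ?E i) $$ (a, b) = \<dots>" .
      then show ?thesis using ab by auto
    qed
    then show "mat_sum m m (\<lambda>i. ?E i * X * ?E i) {1..m} $$ (a, b) = diag_part X $$ (a, b)"
      using ab dX by (auto simp del: index_mult_mat(1))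
  qed (use dX in auto)
  finally show ?thesis .
qed

lemma sym_part_dim [simp]:
  "dim_row (sym_part W) = dim_col W" "dim_col (sym_part W) = dim_row W"
  by (simp_all add: sym_part_def)

lemma transpose_sym_part:
  assumes "dim_row W = dim_col W"
  shows "(sym_part W)\<^sup>T = sym_part W"
  using assms by (intro eq_matI) (auto simp: sym_part_def)

section \<open>Linearity of the matrix-vector product, and the shapes that occur in the
  blocks\<close>

lemma smult_mat_mult_vec:
  assumes "dim_vec v = dim_col (A :: real mat)"
  shows "(k \<cdot>\<^sub>m A) *\<^sub>v v = k \<cdot>\<^sub>v (A *\<^sub>v v)"
  using assms by (intro eq_vecI) (auto simp: scalar_prod_def sum_distrib_left ac_simps)

lemma add_mat_mult_vec:
  fixes A B :: "real mat"
  assumes "dim_row A = dim_row B" "dim_col A = dim_col B" "dim_vec v = dim_col B"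
  shows "(A + B) *\<^sub>v v = A *\<^sub>v v + B *\<^sub>v v"
  using assms by (intro eq_vecI) (auto simp: scalar_prod_def sum.distrib algebra_simps)

lemma minus_mat_mult_vec:
  fixes A B :: "real mat"
  assumes "dim_row A = dim_row B" "dim_col A = dim_col B" "dim_vec v = dim_col B"
  shows "(A - B) *\<^sub>v v = A *\<^sub>v v - B *\<^sub>v v"
  using assms by (intro eq_vecI) (auto simp: scalar_prod_def sum_subtractf algebra_simps)

lemma mult_mat_vec_add:
  fixes A :: "real mat"
  assumes "dim_vec u = dim_vec v" "dim_col A = dim_vec v"
  shows "A *\<^sub>v (u + v) = A *\<^sub>v u + A *\<^sub>v v"
  using assms by (intro eq_vecI) (auto simp: scalar_prod_def sum.distrib algebra_simps)

lemma mult_mat_vec_smult: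
  fixes A :: "real mat"
  assumes "dim_col A = dim_vec v"
  shows "A *\<^sub>v (k \<cdot>\<^sub>v v) = k \<cdot>\<^sub>v (A *\<^sub>v v)"
  using assms by (intro eq_vecI) (auto simp: scalar_prod_def sum_distrib_left ac_simps)

lemma kron_one_left_mult_vec_cols:
  assumes "dim_row X = dim_col M" "dim_col X = p"
  shows "(1\<^sub>m p \<otimes>\<^sub>K M) *\<^sub>v vec_cols X = vec_cols (M * X)"
  using assms by (simp add: kron_mult_vec_cols)

text \<open>The vectorized form of the map X -> K diag(L X), the shape produced by differentiating
  the factor diag(Y^T A Y) of the gradient.\<close>

lemma kron_Delta_kron_mult_vec_cols:
  assumes "dim_row X = dim_col L" "dim_col X = p" "dim_row L = p" "dim_col K = p"
  shows "((1\<^sub>m p \<otimes>\<^sub>K K) * Delta_mat p * (1\<^sub>m p \<otimes>\<^sub>K L)) *\<^sub>v vec_cols X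
    = vec_cols (K * diag_part (L * X))"
proof -
  have "L * X \<in> carrier_mat p p" using assms by (intro carrier_matI) auto
  then show ?thesis using assms
    by (simp add: mat_mult_vec_assoc kron_one_left_mult_vec_cols Delta_mult_vec_cols)
qed

lemma four_block_symmetric:
  assumes "A \<in> carrier_mat a a" "B \<in> carrier_mat a b" "C \<in> carrier_mat b a" "D \<in> carrier_mat b b"
    and "A\<^sup>T = A" "B\<^sup>T = C" "D\<^sup>T = D"
  shows "(four_block_mat A B C D)\<^sup>T = four_block_mat A B C D"
proof -
  have "C\<^sup>T = B" using assms(6) by auto
  then show ?thesis using assms by (simp add: transpose_four_block_mat)
qed

section \<open>Half-vectorization of skew-symmetric matrices\<close>

text \<open>The strict lower triangle, column by column and indexed from 0. This list is the common
  index set of the entries of \<open>veck\<close> and of the columns of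
  \<open>D_mat\<close>.\<close>

definition veck_positions :: "nat \<Rightarrow> (nat \<times> nat) list" where
  "veck_positions m = concat (map (\<lambda>j. map (\<lambda>i. (i, j)) [j + 1..<m]) [0..<m])"

lemma veck_eq: "veck S = vec_of_list (map (\<lambda>ij. S $$ ij) (veck_positions (dim_row S)))"
  by (simp add: veck_def veck_positions_def map_concat comp_def)

lemma set_veck_positions: "set (veck_positions m) = {(i, j). j < i \<and> i < m}"
  by (auto simp: veck_positions_def image_iff)

text \<open>Column j contributes m - 1 - j positions. The triangular number stands on the left so
  that no truncated subtraction occurs.\<close>

lemma length_veck_prefix:
  assumes "k \<le> m"
  shows "length (concat (map (\<lambda>j. map (\<lambda>i. (i, j)) [j + 1..<m]) [0..<k])) + k * (k + 1) div 2 = k * m"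
  using assms
proof (induction k)
  case (Suc k)
  have "Suc k * (Suc k + 1) div 2 = k * (k + 1) div 2 + (k + 1)"
    by (simp add: algebra_simps)
  with Suc show ?case by simp
qed simp

lemma length_veck_positions: "length (veck_positions m) = m * (m - 1) div 2"
proof -
  have "length (veck_positions m) + m * (m + 1) div 2 = m * m"
    using length_veck_prefix[of m m] by (simp add: veck_positions_def)
  moreover have "m * (m - 1) div 2 + m * (m + 1) div 2 = m * m"
  proof -
    have "m * (m - 1) div 2 + m * (m + 1) div 2 = (m * (m - 1) + m * (m + 1)) div 2"
      by (rule div_plus_div_distrib_dvd_left[symmetric]) auto
    also have "m * (m - 1) + m * (m + 1) = 2 * (m * m)"
      by (cases m) (auto simp: algebra_simps)
    finally show ?thesis by simp
  qed
  ultimately show ?thesis by linarith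
qed

text \<open>Links the closed formula for the column index to the list. \<open>veck_index\<close>
  takes and returns values counted from 1, hence the shifts by one; the third claim guarantees that
  the \<open>- 1\<close> does not truncate.\<close>

lemma nth_veck_positions:
  assumes "j < i" "i < m"
  shows "veck_index m (i + 1) (j + 1) - 1 < length (veck_positions m)"
    and "veck_positions m ! (veck_index m (i + 1) (j + 1) - 1) = (i, j)"
    and "1 \<le> veck_index m (i + 1) (j + 1)"
proof -
  let ?f = "\<lambda>j. map (\<lambda>i. (i, j)) [j + 1..<m]"
  let ?pre = "concat (map ?f [0..<j])"
  have split: "[0..<m] = [0..<j] @ j # [j + 1..<m]"
    using assms upt_add_eq_append[of 0 j "m - j"] upt_conv_Cons[of j m] by simp
  have eq: "veck_positions m = ?pre @ ?f j @ concat (map ?f [j + 1..<m])"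
    unfolding veck_positions_def by (subst split) simp
  have len: "length ?pre + j * (j + 1) div 2 = j * m"
    using assms by (intro length_veck_prefix) simp
  \<comment> \<open>The triangular number in \<open>veck_index\<close> is that of j + 1, while the
    columns before j account for that of j. The difference j + 1 gives the offset i - (j + 1) inside
    column j.\<close>
  have "(j + 1) * (j + 1 + 1) div 2 = j * (j + 1) div 2 + (j + 1)"
    by (simp add: algebra_simps)
  then have idx: "veck_index m (i + 1) (j + 1) = length ?pre + (i - (j + 1)) + 1"
    using assms len unfolding veck_index_def by (simp add: algebra_simps)
  have lt: "i - (j + 1) < length (?f j)" using assms by simp
  show "1 \<le> veck_index m (i + 1) (j + 1)" using idx by simp
  show "veck_index m (i + 1) (j + 1) - 1 < length (veck_positions m)"
    unfolding eq idx using lt by simp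
  have "veck_positions m ! (veck_index m (i + 1) (j + 1) - 1) = ?f j ! (i - (j + 1))"
    unfolding eq idx using lt by (simp add: nth_append)
  then show "veck_positions m ! (veck_index m (i + 1) (j + 1) - 1) = (i, j)"
    using assms by simp
qed

lemma distinct_veck_positions: "distinct (veck_positions m)"
proof -
  have "distinct (concat (map (\<lambda>j. map (\<lambda>i. (i, j)) [j + 1..<m]) [0..<k]))" for k
    by (induction k) (auto simp: distinct_map inj_on_def)
  then show ?thesis unfolding veck_positions_def .
qed

lemma index_veck:
  assumes "c < length (veck_positions (dim_row S))"
  shows "veck S $ c = S $$ (veck_positions (dim_row S) ! c)"
  using assms by (simp add: veck_eq index_vec_of_list)

lemma dim_veck [simp]: "dim_vec (veck S) = dim_row S * (dim_row S - 1) div 2"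
  by (simp add: veck_eq length_veck_positions)


lemma D_mat_dim [simp]: "dim_row (D_mat m) = m * m" "dim_col (D_mat m) = m * (m - 1) div 2"
  by (simp_all add: D_mat_def Let_def)

text \<open>Among all summands of \<open>D_mat\<close> only the one for (i + 1, j + 1) reaches
  column c. Its +1 sits at the place of entry (i, j) in vec, its -1 at the place of the transposed
  entry (j, i).\<close>

lemma index_D_mat:
  assumes r: "r < m * m" and c: "c < length (veck_positions m)"
    and ij: "veck_positions m ! c = (i, j)"
  shows "D_mat m $$ (r, c) = of_bool (r = m * j + i) - of_bool (r = m * i + j)"
proof -
  let ?q = "m * (m - 1) div 2"
  let ?P = "{(i, j). 1 \<le> j \<and> j < i \<and> i \<le> m}"
  let ?f = "\<lambda>(i', j'). unit_mat (m * m) ?q (m * (j' - 1) + i') (veck_index m i' j')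
               - unit_mat (m * m) ?q (m * (i' - 1) + j') (veck_index m i' j')"
  have lt: "j < i" "i < m"
    using nth_mem[OF c] unfolding ij set_veck_positions by auto
  have cq: "c < ?q" using c by (simp add: length_veck_positions)
  have idx: "veck_index m (i + 1) (j + 1) = c + 1"
  proof -
    have "veck_index m (i + 1) (j + 1) - 1 = c"
      using nth_eq_iff_index_eq[OF distinct_veck_positions nth_veck_positions(1)[OF lt] c]
        nth_veck_positions(2)[OF lt] ij by simp
    then show ?thesis using nth_veck_positions(3)[OF lt] by linarith
  qed
  \<comment> \<open>Injectivity of \<open>veck_index\<close> on the strict lower triangle: the list
    entry at the common index determines both coordinates.\<close>
  have uniq: "i' = i + 1 \<and> j' = j + 1"
    if "(i', j') \<in> ?P" "veck_index m i' j' = c + 1" for i' j'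
  proof -
    have "veck_positions m ! (veck_index m (i' - 1 + 1) (j' - 1 + 1) - 1) = (i' - 1, j' - 1)"
      using that by (intro nth_veck_positions(2)) auto
    moreover have "veck_index m (i' - 1 + 1) (j' - 1 + 1) - 1 = c"
      using that by simp
    ultimately have "i' - 1 = i" "j' - 1 = j" using ij by simp_all
    then show ?thesis using that by auto
  qed
  have fin: "finite ?P"
    by (rule finite_subset[of _ "{..m} \<times> {..m}"]) auto
  have "D_mat m $$ (r, c) = (\<Sum>x\<in>?P. ?f x $$ (r, c))"
    using r cq by (simp only: D_mat_def Let_def index_mat_sum)
  also have "\<dots> = (\<Sum>x\<in>{(i + 1, j + 1)}. ?f x $$ (r, c))"
  proof (rule sum.mono_neutral_right[OF fin])
    show "{(i + 1, j + 1)} \<subseteq> ?P" using lt by simp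
    show "\<forall>x\<in>?P - {(i + 1, j + 1)}. ?f x $$ (r, c) = 0"
    proof
      fix x assume x: "x \<in> ?P - {(i + 1, j + 1)}"
      obtain i' j' where x_eq: "x = (i', j')" by (cases x)
      have "veck_index m i' j' \<noteq> c + 1" using uniq[of i' j'] x unfolding x_eq by blast
      then have "c + 1 \<noteq> veck_index m i' j'" by metis
      then show "?f x $$ (r, c) = 0"
        using r cq unfolding x_eq
        by (simp only: prod.case index_minus_mat unit_mat_dim index_unit_mat simp_thms if_False diff_self)
    qed
  qed
  also have "\<dots> = of_bool (r = m * j + i) - of_bool (r = m * i + j)"
  proof -
    have "\<And>x. unit_mat (m * m) ?q x (c + 1) $$ (r, c) = of_bool (r + 1 = x)"
      using r cq by simp
    from this[simplified] show ?thesis using r cq by (simp add: idx[simplified] del: index_unit_mat)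
  qed
  finally show ?thesis .
qed


text \<open>Each column of \<open>D_mat\<close> is a difference of two standard basis vectors, so
  pairing it with vec(W) gives W_ij - W_ji. \<open>W\<close> need not be skew, which is what allows
  a change of representative modulo symmetric matrices.\<close>

lemma D_mat_transpose_mult:
  assumes "W \<in> carrier_mat m m"
  shows "(D_mat m)\<^sup>T *\<^sub>v vec_cols W = veck (W - W\<^sup>T)"
proof (rule eq_vecI)
  have dW: "dim_row W = m" "dim_col W = m" using assms by auto
  fix c assume "c < dim_vec (veck (W - W\<^sup>T))"
  then have c: "c < length (veck_positions m)" and cq: "c < m * (m - 1) div 2"
    using dW by (simp_all add: length_veck_positions)
  obtain i j where ij: "veck_positions m ! c = (i, j)" by (cases "veck_positions m ! c")
  have lt: "j < i" "i < m"
    using nth_mem[OF c] unfolding ij set_veck_positions by auto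
  have pos: "m * b + a < m * m" if "a < m" "b < m" for a b
  proof -
    have "m * b + a < m * b + m" using that by simp
    also have "\<dots> = m * (b + 1)" by simp
    also have "\<dots> \<le> m * m" using that by (intro mult_le_mono2) simp
    finally show ?thesis .
  qed
  have at: "(\<Sum>r<m * m. of_bool (r = m * b + a) * vec_cols W $ r) = W $$ (a, b)"
    if "a < m" "b < m" for a b
  proof -
    have "(\<Sum>r<m * m. of_bool (r = m * b + a) * vec_cols W $ r)
        = (\<Sum>r<m * m. if r = m * b + a then vec_cols W $ (m * b + a) else 0)"
      by (intro sum.cong) auto
    also have "\<dots> = W $$ (a, b)" using pos[OF that] that dW by simp
    finally show ?thesis .
  qed
  have "((D_mat m)\<^sup>T *\<^sub>v vec_cols W) $ c = (\<Sum>r<m * m. D_mat m $$ (r, c) * vec_cols W $ r)"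
    using cq dW by (subst index_mult_vec_sum) simp_all
  also have "\<dots> = (\<Sum>r<m * m. of_bool (r = m * j + i) * vec_cols W $ r)
                - (\<Sum>r<m * m. of_bool (r = m * i + j) * vec_cols W $ r)"
    unfolding sum_subtractf[symmetric]
    by (intro sum.cong refl) (simp add: index_D_mat[OF _ c ij] left_diff_distrib)
  also have "\<dots> = W $$ (i, j) - W $$ (j, i)"
    using lt by (simp only: at)
  also have "\<dots> = veck (W - W\<^sup>T) $ c"
    using lt c ij dW by (subst index_veck) simp_all
  finally show "((D_mat m)\<^sup>T *\<^sub>v vec_cols W) $ c = veck (W - W\<^sup>T) $ c" .
qed (use assms in simp)


text \<open>Expresses negation as the scalar -1, so that the scalar rules of
  \<open>mat_expand\<close> carry the sign through products.\<close>

lemma skew_mats_iff: "S \<in> skew_mats m \<longleftrightarrow> S \<in> carrier_mat m m \<and> S\<^sup>T = (-1) \<cdot>\<^sub>m S"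
proof -
  have "- S = (-1) \<cdot>\<^sub>m S" by (intro eq_matI) auto
  then show ?thesis by (simp add: skew_mats_def)
qed

text \<open>A row of \<open>D_mat\<close> belonging to entry (a, b) holds a single +1 below the
  diagonal and a single -1 above it, where skewness restores the sign. On the diagonal the row
  vanishes, and so does the entry of \<open>S\<close>.\<close>

lemma D_mat_mult_veck:
  assumes "S \<in> skew_mats m"
  shows "D_mat m *\<^sub>v veck S = vec_cols S"
proof (rule eq_vecI)
  have S: "S \<in> carrier_mat m m" and ST: "S\<^sup>T = (-1) \<cdot>\<^sub>m S"
    using assms by (auto simp: skew_mats_iff)
  have dS: "dim_row S = m" "dim_col S = m" using S by auto
  have skew: "S $$ (a, b) = - S $$ (b, a)" if "a < m" "b < m" for a b
    using that dS arg_cong[OF ST, of "\<lambda>M. M $$ (b, a)"] by simp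
  let ?L = "veck_positions m" and ?P = "{(i, j). j < i \<and> i < m}"
  fix r assume "r < dim_vec (vec_cols S)"
  then have r: "r < m * m" using dS by simp
  define a b where "a = r mod m" and "b = r div m"
  have ab: "a < m" "b < m" "r = m * b + a"
    using r by (auto simp: a_def b_def mod_div_less_mult)
  \<comment> \<open>Uniqueness of quotient and remainder in division by m.\<close>
  have eq_iff: "(r = m * j + i) = (a = i \<and> b = j)" if "i < m" for i j
    using that by (auto simp: a_def b_def)
  have fin: "finite ?P"
    by (rule finite_subset[of _ "{..m} \<times> {..m}"]) auto
  have "(D_mat m *\<^sub>v veck S) $ r
      = (\<Sum>c<length ?L. D_mat m $$ (r, c) * S $$ (?L ! c))"
    using r dS by (subst index_mult_vec_sum) (auto simp: index_veck length_veck_positions intro!: sum.cong)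
  also have "\<dots> = (\<Sum>c<length ?L. case ?L ! c of (i, j) \<Rightarrow>
      (of_bool (a = i \<and> b = j) - of_bool (a = j \<and> b = i)) * S $$ (i, j))"
  proof (intro sum.cong refl)
    fix c assume "c \<in> {..<length ?L}"
    then have c: "c < length ?L" by simp
    obtain i j where ij: "?L ! c = (i, j)" by (cases "?L ! c")
    have "j < i" "i < m"
      using nth_mem[OF c] unfolding ij set_veck_positions by auto
    then show "D_mat m $$ (r, c) * S $$ (?L ! c) = (case ?L ! c of (i, j) \<Rightarrow>
      (of_bool (a = i \<and> b = j) - of_bool (a = j \<and> b = i)) * S $$ (i, j))"
      using index_D_mat[OF r c ij] eq_iff[of i j] eq_iff[of j i] ij by simp
  qed
  \<comment> \<open>The list has no repetitions, so its column numbers are in bijection with the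
    positions themselves.\<close>
  also have "\<dots> = (\<Sum>(i, j)\<in>?P. (of_bool (a = i \<and> b = j) - of_bool (a = j \<and> b = i)) * S $$ (i, j))"
    by (rule sum.reindex_bij_betw)
       (use bij_betw_nth[OF distinct_veck_positions refl refl] set_veck_positions in simp)
  \<comment> \<open>The contribution -S_ba equals S_ab. If a and b differ, exactly one of (a, b) and
    (b, a) lies in \<open>?P\<close>; if they agree, neither does.\<close>
  also have "\<dots> = (\<Sum>x\<in>?P. (if x = (a, b) then S $$ (a, b) else 0) + (if x = (b, a) then S $$ (a, b) else 0))"
  proof (intro sum.cong refl)
    fix x assume "x \<in> ?P"
    moreover obtain i j where x: "x = (i, j)" by (cases x)
    ultimately have "i \<noteq> j" by simp
    then show "(case x of (i, j) \<Rightarrow> (of_bool (a = i \<and> b = j) - of_bool (a = j \<and> b = i)) * S $$ (i, j))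
      = (if x = (a, b) then S $$ (a, b) else 0) + (if x = (b, a) then S $$ (a, b) else 0)"
      using skew[OF ab(2,1)] unfolding x by (cases "a = i \<and> b = j"; cases "a = j \<and> b = i") auto
  qed
  also have "\<dots> = S $$ (a, b)"
  proof -
    have "S $$ (a, a) = 0" using skew[of a a] ab by linarith
    then show ?thesis using fin ab
      by (cases "a = b") (auto simp: sum.distrib intro!: sum.neutral)
  qed
  also have "\<dots> = vec_cols S $ r" using r dS by (simp add: a_def b_def)
  finally show "(D_mat m *\<^sub>v veck S) $ r = vec_cols S $ r" .
qed (use assms in \<open>auto simp: skew_mats_def\<close>)

section \<open>Derivatives of the objective\<close>

text \<open>Along a line the diagonal entries are quadratic polynomials in t. Symmetry of
  \<open>A\<close> makes the two cross terms have equal diagonals, whence the factor 2.\<close>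

lemma index_transpose_mult_mult_line:
  fixes A X E :: "real mat"
  assumes "A \<in> carrier_mat n n" "A\<^sup>T = A" "X \<in> carrier_mat n p" "E \<in> carrier_mat n p" "i < p"
  shows "((X + t \<cdot>\<^sub>m E)\<^sup>T * A * (X + t \<cdot>\<^sub>m E)) $$ (i, i) = (X\<^sup>T * A * X) $$ (i, i)
    + 2 * t * (X\<^sup>T * A * E) $$ (i, i) + t\<^sup>2 * (E\<^sup>T * A * E) $$ (i, i)"
proof -
  have d: "dim_row A = n" "dim_col A = n" "dim_row X = n" "dim_col X = p" "dim_row E = n"
    "dim_col E = p" using assms by auto
  have "E\<^sup>T * A * X = (X\<^sup>T * A * E)\<^sup>T"
    using assms(2) by (simp add: mat_expand d)
  then have sym: "(E\<^sup>T * A * X) $$ (i, i) = (X\<^sup>T * A * E) $$ (i, i)"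
    using assms(5) by (simp add: d del: index_mult_mat(1))
  have "(X + t \<cdot>\<^sub>m E)\<^sup>T * A * (X + t \<cdot>\<^sub>m E)
      = X\<^sup>T * A * X + t \<cdot>\<^sub>m (X\<^sup>T * A * E) + t \<cdot>\<^sub>m (E\<^sup>T * A * X) + t\<^sup>2 \<cdot>\<^sub>m (E\<^sup>T * A * E)"
    by (intro eq_matI)
       (simp_all add: mat_expand d power2_eq_square smult_add_mat smult_smult_mat del: index_mult_mat(1))
  then show ?thesis
    using assms(5) sym by (simp add: d del: index_mult_mat(1))
qed

lemma frob_norm_diag_part_square:
  assumes "W \<in> carrier_mat p p"
  shows "(frob_norm (diag_part W))\<^sup>2 = (\<Sum>i<p. (W $$ (i, i))\<^sup>2)"
proof -
  have d: "dim_row W = p" using assms by auto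
  have "(frob_norm (diag_part W))\<^sup>2 = (\<Sum>i<p. \<Sum>j<p. (diag_part W $$ (i, j))\<^sup>2)"
    unfolding frob_norm_def d diag_part_dim
    by (intro real_sqrt_pow2 sum_nonneg) auto
  also have "\<dots> = (\<Sum>i<p. \<Sum>j<p. if j = i then (W $$ (i, i))\<^sup>2 else 0)"
    by (intro sum.cong refl) (auto simp: d)
  finally show ?thesis by simp
qed

lemma objective_eq:
  assumes "\<And>l. l \<in> {1..N} \<Longrightarrow> A l \<in> carrier_mat n n" "X \<in> carrier_mat n p"
  shows "objective N A X = - (\<Sum>l=1..N. \<Sum>i<p. ((X\<^sup>T * A l * X) $$ (i, i))\<^sup>2)"
  unfolding objective_def using assms
  by (intro arg_cong[of _ _ uminus] sum.cong refl frob_norm_diag_part_square) auto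

lemma index_mult_unit_mat:
  assumes "i < dim_row M" "j < p" "a < n" "b < p" "dim_col M = n"
  shows "(M * unit_mat n p (a + 1) (b + 1)) $$ (i, j) = (if j = b then M $$ (i, a) else 0)"
proof -
  have "(M * unit_mat n p (a + 1) (b + 1)) $$ (i, j)
      = (\<Sum>k<n. M $$ (i, k) * unit_mat n p (a + 1) (b + 1) $$ (k, j))"
    using assms by (subst index_mult_mat_sum) simp_all
  also have "\<dots> = (\<Sum>k<n. if k = a then (if j = b then M $$ (i, a) else 0) else 0)"
    using assms by (intro sum.cong) auto
  finally show ?thesis using assms by simp
qed

text \<open>In the direction E_ab the product X^T A E has only column b nonzero, so just one
  diagonal entry varies to first order, with half its slope equal to (A X)_ab by symmetry of A. The
  point \<open>X\<close> is arbitrary, since this formula is differentiated once more.\<close>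

lemma euclid_grad_objective:
  assumes A: "\<And>l. l \<in> {1..N} \<Longrightarrow> A l \<in> carrier_mat n n"
    and sym: "\<And>l. l \<in> {1..N} \<Longrightarrow> (A l)\<^sup>T = A l"
    and X: "X \<in> carrier_mat n p"
  shows "euclid_grad p n (objective N A) X =
    mat_sum n p (\<lambda>l. (-4) \<cdot>\<^sub>m (A l * X * diag_part (X\<^sup>T * A l * X))) {1..N}"
proof (rule eq_matI)
  have dX: "dim_row X = n" "dim_col X = p" using X by auto
  have dA: "dim_row (A l) = n" "dim_col (A l) = n" if "l \<in> {1..N}" for l using A[OF that] by auto
  fix a b assume "a < dim_row (mat_sum n p (\<lambda>l. (-4) \<cdot>\<^sub>m (A l * X * diag_part (X\<^sup>T * A l * X))) {1..N})"
    "b < dim_col (mat_sum n p (\<lambda>l. (-4) \<cdot>\<^sub>m (A l * X * diag_part (X\<^sup>T * A l * X))) {1..N})"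
  then have ab: "a < n" "b < p" by simp_all
  let ?E = "unit_mat n p (a + 1) (b + 1)"
  let ?w = "\<lambda>l i. (X\<^sup>T * A l * X) $$ (i, i)" and ?u = "\<lambda>l i. (X\<^sup>T * A l * ?E) $$ (i, i)"
    and ?v = "\<lambda>l i. (?E\<^sup>T * A l * ?E) $$ (i, i)"
  have E: "?E \<in> carrier_mat n p" by (intro carrier_matI) simp_all
  have eq: "objective N A (X + t \<cdot>\<^sub>m ?E)
      = - (\<Sum>l=1..N. \<Sum>i<p. (?w l i + 2 * t * ?u l i + t\<^sup>2 * ?v l i)\<^sup>2)" for t
    using A sym X E
    by (subst objective_eq[of _ _ n _ p])
       (auto intro!: sum.cong simp: index_transpose_mult_mult_line[of _ n _ p] simp del: index_mult_mat(1))
  \<comment> \<open>The chain rule at t = 0: twice w times the slope 2 u. This is the origin of the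
    constant 4.\<close>
  have "((\<lambda>t::real. (w + 2 * t * u + t\<^sup>2 * v)\<^sup>2) has_real_derivative 4 * w * u) (at 0)" for w u v :: real
    by (auto intro!: derivative_eq_intros)
  then have "((\<lambda>t. - (\<Sum>l=1..N. \<Sum>i<p. (?w l i + 2 * t * ?u l i + t\<^sup>2 * ?v l i)\<^sup>2)) has_real_derivative
      - (\<Sum>l=1..N. \<Sum>i<p. 4 * ?w l i * ?u l i)) (at 0)"
    by (intro DERIV_minus DERIV_sum)
  then have "deriv (\<lambda>t. objective N A (X + t \<cdot>\<^sub>m ?E)) 0 = - (\<Sum>l=1..N. \<Sum>i<p. 4 * ?w l i * ?u l i)"
    unfolding eq by (rule DERIV_imp_deriv)
  also have "\<dots> = - (\<Sum>l=1..N. 4 * ?w l b * (A l * X) $$ (a, b))"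
  proof (intro arg_cong[of _ _ uminus] sum.cong refl)
    fix l assume l: "l \<in> {1..N}"
    have "X\<^sup>T * A l = (A l * X)\<^sup>T" using sym[OF l] by (simp add: mat_expand dX dA[OF l])
    then have "?u l i = (if i = b then (A l * X) $$ (a, b) else 0)" if "i < p" for i
      using that ab by (subst index_mult_unit_mat) (auto simp: dX dA[OF l] simp del: index_mult_mat(1))
    then have "(\<Sum>i<p. 4 * ?w l i * ?u l i)
        = (\<Sum>i<p. if i = b then 4 * ?w l b * (A l * X) $$ (a, b) else 0)"
      by (intro sum.cong) auto
    then show "(\<Sum>i<p. 4 * ?w l i * ?u l i) = 4 * ?w l b * (A l * X) $$ (a, b)"
      using ab by simp
  qed
  also have "\<dots> = (\<Sum>l=1..N. (-4) * (A l * X * diag_part (X\<^sup>T * A l * X)) $$ (a, b))"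
    unfolding sum_negf[symmetric] using ab
    by (intro sum.cong refl, subst index_mult_diag_part) (simp_all add: dX dA del: index_mult_mat(1))
  finally show "euclid_grad p n (objective N A) X $$ (a, b) =
      mat_sum n p (\<lambda>l. (-4) \<cdot>\<^sub>m (A l * X * diag_part (X\<^sup>T * A l * X))) {1..N} $$ (a, b)"
    using ab by (simp add: euclid_grad_def dX dA del: index_mult_mat(1))
qed (simp_all add: euclid_grad_def)

text \<open>Multiplication by a diagonal part scales columns, so entry (a, b) of the gradient is a
  sum of products of a linear and a quadratic polynomial in t. The product rule at t = 0 leaves the
  two terms, and the slope 2 u of the quadratic factor gives the 2.\<close>

lemma dir_deriv_euclid_grad_objective:
  assumes A: "\<And>l. l \<in> {1..N} \<Longrightarrow> A l \<in> carrier_mat n n"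
    and sym: "\<And>l. l \<in> {1..N} \<Longrightarrow> (A l)\<^sup>T = A l"
    and X: "X \<in> carrier_mat n p" and \<xi>: "\<xi> \<in> carrier_mat n p"
  shows "dir_deriv p n (euclid_grad p n (objective N A)) X \<xi> =
    mat_sum n p (\<lambda>l. (-4) \<cdot>\<^sub>m (A l * \<xi> * diag_part (X\<^sup>T * A l * X)
       + 2 \<cdot>\<^sub>m (A l * X * diag_part (X\<^sup>T * A l * \<xi>)))) {1..N}" (is "_ = ?R")
proof (rule eq_matI)
  have dX: "dim_row X = n" "dim_col X = p" "dim_row \<xi> = n" "dim_col \<xi> = p" using X \<xi> by auto
  have dA: "dim_row (A l) = n" "dim_col (A l) = n" if "l \<in> {1..N}" for l using A[OF that] by auto
  fix a b assume "a < dim_row ?R" "b < dim_col ?R"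
  then have ab: "a < n" "b < p" by simp_all
  let ?w = "\<lambda>l. (X\<^sup>T * A l * X) $$ (b, b)" and ?u = "\<lambda>l. (X\<^sup>T * A l * \<xi>) $$ (b, b)"
    and ?v = "\<lambda>l. (\<xi>\<^sup>T * A l * \<xi>) $$ (b, b)"
    and ?x = "\<lambda>l. (A l * X) $$ (a, b)" and ?y = "\<lambda>l. (A l * \<xi>) $$ (a, b)"
  have line: "(A l * (X + t \<cdot>\<^sub>m \<xi>)) $$ (a, b) = ?x l + t * ?y l" if "l \<in> {1..N}" for l t
    using ab by (simp add: mat_expand dX dA[OF that] del: index_mult_mat(1))
  have eq: "euclid_grad p n (objective N A) (X + t \<cdot>\<^sub>m \<xi>) $$ (a, b)
      = (\<Sum>l=1..N. (-4) * ((?x l + t * ?y l) * (?w l + 2 * t * ?u l + t\<^sup>2 * ?v l)))" for t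
  proof -
    have c: "X + t \<cdot>\<^sub>m \<xi> \<in> carrier_mat n p" using X \<xi> by simp
    have "euclid_grad p n (objective N A) (X + t \<cdot>\<^sub>m \<xi>) $$ (a, b)
      = (\<Sum>l=1..N. (-4) * (A l * (X + t \<cdot>\<^sub>m \<xi>) *
          diag_part ((X + t \<cdot>\<^sub>m \<xi>)\<^sup>T * A l * (X + t \<cdot>\<^sub>m \<xi>))) $$ (a, b))"
      using ab A sym c by (subst euclid_grad_objective) (auto simp add: dX dA del: index_mult_mat(1))
    also have "\<dots> = (\<Sum>l=1..N. (-4) * ((?x l + t * ?y l) * (?w l + 2 * t * ?u l + t\<^sup>2 * ?v l)))"
    proof (intro sum.cong refl arg_cong[of _ _ "(*) (-4)"])
      fix l assume l: "l \<in> {1..N}"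
      show "(A l * (X + t \<cdot>\<^sub>m \<xi>) * diag_part ((X + t \<cdot>\<^sub>m \<xi>)\<^sup>T * A l * (X + t \<cdot>\<^sub>m \<xi>))) $$ (a, b)
          = (?x l + t * ?y l) * (?w l + 2 * t * ?u l + t\<^sup>2 * ?v l)"
        using ab
        by (subst index_mult_diag_part)
           (simp_all only: line[OF l] index_transpose_mult_mult_line[OF A[OF l] sym[OF l] X \<xi> ab(2)]
             index_mult_mat(2,3) index_add_mat(2,3) index_smult_mat(2,3) index_transpose_mat(2,3) dX dA[OF l])
    qed
    finally show ?thesis .
  qed
  have "((\<lambda>t::real. (-4) * ((x + t * y) * (w + 2 * t * u + t\<^sup>2 * v))) has_real_derivative
      (-4) * (y * w + 2 * (x * u))) (at 0)" for x y w u v :: real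
    by (auto intro!: derivative_eq_intros)
  then have "((\<lambda>t. \<Sum>l=1..N. (-4) * ((?x l + t * ?y l) * (?w l + 2 * t * ?u l + t\<^sup>2 * ?v l)))
      has_real_derivative (\<Sum>l=1..N. (-4) * (?y l * ?w l + 2 * (?x l * ?u l)))) (at 0)"
    by (intro DERIV_sum)
  then have "deriv (\<lambda>t. euclid_grad p n (objective N A) (X + t \<cdot>\<^sub>m \<xi>) $$ (a, b)) 0
      = (\<Sum>l=1..N. (-4) * (?y l * ?w l + 2 * (?x l * ?u l)))"
    unfolding eq by (rule DERIV_imp_deriv)
  also have "\<dots> = (\<Sum>l=1..N. (-4) * ((A l * \<xi> * diag_part (X\<^sup>T * A l * X)) $$ (a, b)
       + 2 * (A l * X * diag_part (X\<^sup>T * A l * \<xi>)) $$ (a, b)))"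
    using ab by (intro sum.cong refl) (simp add: index_mult_diag_part dX dA del: index_mult_mat(1))
  finally show "dir_deriv p n (euclid_grad p n (objective N A)) X \<xi> $$ (a, b) = ?R $$ (a, b)"
    using ab by (simp add: dir_deriv_def dX dA del: index_mult_mat(1))
qed (simp_all add: dir_deriv_def)

section \<open>The Hessian in tangent coordinates\<close>

text \<open>The matrix with column blocks \<open>Y\<close> and \<open>Yp\<close> is square, and its
  transpose is a left inverse; therefore it is also a right inverse.\<close>

lemma orthonormal_completion:
  fixes Y Yp :: "real mat"
  assumes Y: "Y \<in> carrier_mat n p" and Yp: "Yp \<in> carrier_mat n (n - p)" and "p \<le> n"
    and "Y\<^sup>T * Y = 1\<^sub>m p" "Y\<^sup>T * Yp = 0\<^sub>m p (n - p)" "Yp\<^sup>T * Yp = 1\<^sub>m (n - p)"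
  shows "Y * Y\<^sup>T + Yp * Yp\<^sup>T = 1\<^sub>m n"
proof -
  \<comment> \<open>Two lower blocks without rows turn the juxtaposition of \<open>Y\<close> and
    \<open>Yp\<close> into a four-block matrix.\<close>
  define Q where "Q = four_block_mat Y Yp (0\<^sub>m 0 p) (0\<^sub>m 0 (n - p))"
  have zc: "0\<^sub>m 0 p \<in> carrier_mat 0 p" "0\<^sub>m 0 (n - p) \<in> carrier_mat 0 (n - p)" by auto
  have Q: "Q \<in> carrier_mat n n"
    using four_block_carrier_mat[OF Y zc(2)] \<open>p \<le> n\<close> by (simp add: Q_def)
  have QT: "Q\<^sup>T = four_block_mat (Y\<^sup>T) (0\<^sub>m p 0) (Yp\<^sup>T) (0\<^sub>m (n - p) 0)"
    unfolding Q_def by (subst transpose_four_block_mat[OF Y Yp zc]) simp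
  have YpY: "Yp\<^sup>T * Y = 0\<^sub>m (n - p) p"
  proof -
    have "Yp\<^sup>T * Y = (Y\<^sup>T * Yp)\<^sup>T" using Y Yp by (simp add: mat_expand)
    then show ?thesis using assms(5) by simp
  qed
  have "Q\<^sup>T * Q = four_block_mat (1\<^sub>m p) (0\<^sub>m p (n - p)) (0\<^sub>m (n - p) p) (1\<^sub>m (n - p))"
    unfolding QT unfolding Q_def
    by (subst mult_four_block_mat[of _ p n _ 0 _ "n - p" _ _ p _ "n - p"])
       (use assms YpY in auto)
  also have "\<dots> = 1\<^sub>m n"
    using \<open>p \<le> n\<close> by (intro eq_matI) auto
  finally have "Q\<^sup>T * Q = 1\<^sub>m n" .
  then have "Q * Q\<^sup>T = 1\<^sub>m n"
    using Q by (intro mat_mult_left_right_inverse[of "Q\<^sup>T" n Q]) auto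
  moreover have "Q * Q\<^sup>T = four_block_mat (Y * Y\<^sup>T + Yp * Yp\<^sup>T) (0\<^sub>m n 0) (0\<^sub>m 0 n) (0\<^sub>m 0 0)"
    unfolding QT unfolding Q_def
    by (subst mult_four_block_mat[of _ n p _ "n - p" _ 0 _ _ n _ 0])
       (use Y Yp in auto)
  moreover have "\<dots> = Y * Y\<^sup>T + Yp * Yp\<^sup>T"
    using Y Yp by (intro eq_matI) auto
  ultimately show ?thesis by simp
qed

section \<open>Splitting of tangent vectors along \<open>Y\<close> and \<open>Yp\<close>, and the
  canonical metric\<close>

locale stiefel_point =
  fixes n p :: nat and Y Yp :: "real mat"
  assumes p_le_n: "p \<le> n"
    and Y: "Y \<in> carrier_mat n p" and Yp: "Yp \<in> carrier_mat n (n - p)"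
    and YY: "Y\<^sup>T * Y = 1\<^sub>m p" and YYp: "Y\<^sup>T * Yp = 0\<^sub>m p (n - p)"
    and YpYp: "Yp\<^sup>T * Yp = 1\<^sub>m (n - p)"
begin

lemma dims [simp]: "dim_row Y = n" "dim_col Y = p" "dim_row Yp = n" "dim_col Yp = n - p"
  using Y Yp by auto

lemma YpY: "Yp\<^sup>T * Y = 0\<^sub>m (n - p) p"
proof -
  have "Yp\<^sup>T * Y = (Y\<^sup>T * Yp)\<^sup>T" by (simp add: mat_expand)
  then show ?thesis using YYp by simp
qed

text \<open>The orthonormality relations with a right factor attached. In right-nested products the
  two factors to be cancelled never form a subterm of their own.\<close>

lemma cancel:
  "dim_row X = p \<Longrightarrow> Y\<^sup>T * (Y * X) = X"
  "dim_row X = n - p \<Longrightarrow> Yp\<^sup>T * (Yp * X) = X"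
  "dim_row X = p \<Longrightarrow> Yp\<^sup>T * (Y * X) = 0\<^sub>m (n - p) (dim_col X)"
  "dim_row X = n - p \<Longrightarrow> Y\<^sup>T * (Yp * X) = 0\<^sub>m p (dim_col X)"
  by (simp_all add: mult_mat_assoc[symmetric] YY YpYp YpY YYp del: assoc_mult_mat)

lemmas orth = YY YpYp YpY YYp cancel

lemma complete: "Y * Y\<^sup>T + Yp * Yp\<^sup>T = 1\<^sub>m n"
  using orthonormal_completion[OF Y Yp p_le_n YY YYp YpYp] .

lemma decomp_in_tangent:
  assumes B: "B \<in> skew_mats p" and C: "C \<in> carrier_mat (n - p) p"
  shows "Y * B + Yp * C \<in> stiefel_tangent p n Y"
proof -
  have d: "dim_row B = p" "dim_col B = p" "dim_row C = n - p" "dim_col C = p" "B\<^sup>T = (-1) \<cdot>\<^sub>m B"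
    using B C by (auto simp: skew_mats_iff)
  have "(Y * B + Yp * C)\<^sup>T * Y + Y\<^sup>T * (Y * B + Yp * C) = 0\<^sub>m p p"
    by (intro eq_matI) (simp_all add: mat_expand orth d del: index_mult_mat(1))
  then show ?thesis by (auto simp: stiefel_tangent_def d intro!: carrier_matI)
qed

text \<open>The coordinates are the products of Y^T and Yp^T with the vector; tangency says
  precisely that the first of them is skew.\<close>

lemma tangent_decomp:
  assumes "\<eta> \<in> stiefel_tangent p n Y"
  obtains E F where "E \<in> skew_mats p" "F \<in> carrier_mat (n - p) p" "\<eta> = Y * E + Yp * F"
proof -
  have eta: "\<eta> \<in> carrier_mat n p" and tan: "\<eta>\<^sup>T * Y + Y\<^sup>T * \<eta> = 0\<^sub>m p p"
    using assms by (auto simp: stiefel_tangent_def)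
  have d: "dim_row \<eta> = n" "dim_col \<eta> = p" using eta by auto
  have "(Y\<^sup>T * \<eta>)\<^sup>T = (-1) \<cdot>\<^sub>m (Y\<^sup>T * \<eta>)"
  proof (rule eq_matI)
    fix i j assume "i < dim_row ((-1) \<cdot>\<^sub>m (Y\<^sup>T * \<eta>))" "j < dim_col ((-1) \<cdot>\<^sub>m (Y\<^sup>T * \<eta>))"
    then have ij: "i < p" "j < p" by (simp_all add: d)
    have "(\<eta>\<^sup>T * Y + Y\<^sup>T * \<eta>) $$ (i, j) = 0" using tan ij by simp
    then show "(Y\<^sup>T * \<eta>)\<^sup>T $$ (i, j) = ((-1) \<cdot>\<^sub>m (Y\<^sup>T * \<eta>)) $$ (i, j)"
      using ij by (simp add: mat_expand d del: index_mult_mat(1))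
  qed (simp_all add: d)
  then have 1: "Y\<^sup>T * \<eta> \<in> skew_mats p"
    by (auto simp: skew_mats_iff d intro!: carrier_matI)
  have 2: "Yp\<^sup>T * \<eta> \<in> carrier_mat (n - p) p" by (intro carrier_matI) (simp_all add: d)
  have "\<eta> = (Y * Y\<^sup>T + Yp * Yp\<^sup>T) * \<eta>" unfolding complete using eta by simp
  then have "\<eta> = Y * (Y\<^sup>T * \<eta>) + Yp * (Yp\<^sup>T * \<eta>)" by (simp add: mat_expand d)
  with 1 2 show ?thesis by (rule that)
qed

text \<open>Left multiplication by Y^T and by Yp^T reads off the two coordinates.\<close>

lemma decomp_unique:
  assumes "B \<in> carrier_mat p p" "C \<in> carrier_mat (n - p) p"
    and "B' \<in> carrier_mat p p" "C' \<in> carrier_mat (n - p) p"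
    and eq: "Y * B + Yp * C = Y * B' + Yp * C'"
  shows "B = B'" "C = C'"
proof -
  have d: "dim_row B = p" "dim_col B = p" "dim_row C = n - p" "dim_col C = p"
    "dim_row B' = p" "dim_col B' = p" "dim_row C' = n - p" "dim_col C' = p"
    using assms by auto
  have "Y\<^sup>T * (Y * B + Yp * C) = B" "Yp\<^sup>T * (Y * B + Yp * C) = C"
    "Y\<^sup>T * (Y * B' + Yp * C') = B'" "Yp\<^sup>T * (Y * B' + Yp * C') = C'"
    using assms(1-4) by (simp_all add: mat_expand orth d)
  then show "B = B'" "C = C'" using eq by simp_all
qed

text \<open>The middle matrix of the metric sends \<open>Y\<close> to half of itself and fixes
  \<open>Yp\<close>, so the two parts are orthogonal and only the first is halved.\<close>

lemma canonical_metric_decomp: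
  assumes B: "B \<in> carrier_mat p p" and C: "C \<in> carrier_mat (n - p) p"
    and E: "E \<in> carrier_mat p p" and F: "F \<in> carrier_mat (n - p) p"
  shows "canonical_metric n Y (Y * B + Yp * C) (Y * E + Yp * F)
    = (1/2) * trace_mat (B\<^sup>T * E) + trace_mat (C\<^sup>T * F)"
proof -
  have d: "dim_row B = p" "dim_col B = p" "dim_row C = n - p" "dim_col C = p"
    "dim_row E = p" "dim_col E = p" "dim_row F = n - p" "dim_col F = p"
    using assms by auto
  have "(Y * B + Yp * C)\<^sup>T * (1\<^sub>m n - (1/2) \<cdot>\<^sub>m (Y * Y\<^sup>T)) * (Y * E + Yp * F)
     = (1/2) \<cdot>\<^sub>m (B\<^sup>T * E) + C\<^sup>T * F"
    by (intro eq_matI) (simp_all add: mat_expand orth d del: index_mult_mat(1))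
  then show ?thesis
    unfolding canonical_metric_def by (simp add: trace_mat_add trace_mat_smult d)
qed

text \<open>\<open>THE\<close> requires that the candidate satisfy the defining equation for all
  tangent vectors and that every other solution equal it. Both are decided in coordinates.\<close>

lemma canonical_hess_eqI:
  assumes G: "hess_form p n F Y \<xi> \<in> carrier_mat n p"
  defines "W \<equiv> Y\<^sup>T * hess_form p n F Y \<xi>"
  shows "canonical_hess p n F Y \<xi> = Y * (W - W\<^sup>T) + Yp * (Yp\<^sup>T * hess_form p n F Y \<xi>)"
    and "W - W\<^sup>T \<in> skew_mats p"
proof -
  let ?G = "hess_form p n F Y \<xi>"
  have d: "dim_row ?G = n" "dim_col ?G = p" using G by auto
  have dW [simp]: "dim_row W = p" "dim_col W = p" by (simp_all add: W_def d)
  let ?B = "W - W\<^sup>T" and ?C = "Yp\<^sup>T * ?G"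
  show B: "?B \<in> skew_mats p"
    by (auto simp: skew_mats_iff intro!: carrier_matI eq_matI)
  have B': "?B \<in> carrier_mat p p" and C: "?C \<in> carrier_mat (n - p) p"
    by (intro carrier_matI; simp add: d)+
  have metric: "canonical_metric n Y (Y * ?B + Yp * ?C) \<eta> = trace_mat (?G\<^sup>T * \<eta>)"
    if eta: "\<eta> \<in> stiefel_tangent p n Y" for \<eta>
  proof -
    obtain E K where E: "E \<in> skew_mats p" and K: "K \<in> carrier_mat (n - p) p"
      and eq: "\<eta> = Y * E + Yp * K" using tangent_decomp[OF eta] .
    have dE: "dim_row E = p" "dim_col E = p" "dim_row K = n - p" "dim_col K = p" "E\<^sup>T = (-1) \<cdot>\<^sub>m E"
      and E': "E \<in> carrier_mat p p"
      using E K by (auto simp: skew_mats_iff)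
    \<comment> \<open>Against a skew \<open>E\<close> the matrices W and W^T have opposite traces.
      Hence half the trace of (W - W^T)^T E is the full trace of W^T E.\<close>
    have "trace_mat (W * E) = trace_mat ((W * E)\<^sup>T)" by (simp add: trace_mat_transpose dE)
    also have "(W * E)\<^sup>T = (-1) \<cdot>\<^sub>m (E * W\<^sup>T)" by (simp add: mat_expand dE)
    also have "trace_mat \<dots> = - trace_mat (W\<^sup>T * E)"
      by (subst trace_mat_smult) (simp_all add: dE trace_mat_mult_comm[of E])
    finally have tr: "trace_mat (W * E) = - trace_mat (W\<^sup>T * E)" .
    have "?B\<^sup>T * E = W\<^sup>T * E - W * E" by (simp add: mat_expand dE)
    then have "(1/2) * trace_mat (?B\<^sup>T * E) = trace_mat (W\<^sup>T * E)"
      using tr by (simp add: trace_mat_minus dE)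
    moreover have "?G\<^sup>T * \<eta> = W\<^sup>T * E + ?C\<^sup>T * K"
      unfolding eq W_def by (simp add: mat_expand d dE)
    ultimately show ?thesis
      unfolding eq by (simp add: canonical_metric_decomp[OF B' C E' K] trace_mat_add dE d)
  qed
  show "canonical_hess p n F Y \<xi> = Y * ?B + Yp * ?C"
    unfolding canonical_hess_def
  proof (rule the_equality)
    show "Y * ?B + Yp * ?C \<in> stiefel_tangent p n Y \<and>
      (\<forall>\<eta>\<in>stiefel_tangent p n Y. canonical_metric n Y (Y * ?B + Yp * ?C) \<eta> = trace_mat (?G\<^sup>T * \<eta>))"
      using decomp_in_tangent[OF B C] metric by blast
  next
    fix \<zeta>
    assume \<zeta>: "\<zeta> \<in> stiefel_tangent p n Y \<and>
      (\<forall>\<eta>\<in>stiefel_tangent p n Y. canonical_metric n Y \<zeta> \<eta> = trace_mat (?G\<^sup>T * \<eta>))"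
    then obtain E K where E: "E \<in> skew_mats p" and K: "K \<in> carrier_mat (n - p) p"
      and eq: "\<zeta> = Y * E + Yp * K" using tangent_decomp by blast
    have dE: "dim_row E = p" "dim_col E = p" "dim_row K = n - p" "dim_col K = p" "E\<^sup>T = (-1) \<cdot>\<^sub>m E"
      and E': "E \<in> carrier_mat p p"
      using E K by (auto simp: skew_mats_iff)
    \<comment> \<open>The two solutions are compared on their own difference, which is again
      tangent. The result is 1/2 tr(X^T X) + tr(V^T V) = 0 with both terms nonnegative.\<close>
    let ?X = "E - ?B" and ?V = "K - ?C"
    have X: "?X \<in> skew_mats p"
      using dE by (auto simp: skew_mats_iff intro!: carrier_matI eq_matI)
        (metis (no_types) index_smult_mat(1) index_transpose_mat(1) mult_minus1 minus_diff_eq)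
    have X': "?X \<in> carrier_mat p p" and V: "?V \<in> carrier_mat (n - p) p"
      by (intro carrier_matI; simp add: d dE)+
    have \<eta>: "Y * ?X + Yp * ?V \<in> stiefel_tangent p n Y" by (rule decomp_in_tangent[OF X V])
    have "canonical_metric n Y \<zeta> (Y * ?X + Yp * ?V) = canonical_metric n Y (Y * ?B + Yp * ?C) (Y * ?X + Yp * ?V)"
      using \<zeta> metric[OF \<eta>] \<eta> by simp
    then have "(1/2) * trace_mat (E\<^sup>T * ?X) + trace_mat (K\<^sup>T * ?V)
        = (1/2) * trace_mat (?B\<^sup>T * ?X) + trace_mat (?C\<^sup>T * ?V)"
      unfolding eq canonical_metric_decomp[OF E' K X' V] canonical_metric_decomp[OF B' C X' V] .
    moreover have "?X\<^sup>T * ?X = E\<^sup>T * ?X - ?B\<^sup>T * ?X" "?V\<^sup>T * ?V = K\<^sup>T * ?V - ?C\<^sup>T * ?V"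
      using X' V E' B' K C
      by (simp_all add: transpose_minus_mat minus_mult_mat d dE)
    ultimately have "(1/2) * trace_mat (?X\<^sup>T * ?X) + trace_mat (?V\<^sup>T * ?V) = 0"
      by (simp add: trace_mat_minus d dE field_simps)
    then have "trace_mat (?X\<^sup>T * ?X) = 0" "trace_mat (?V\<^sup>T * ?V) = 0"
      using trace_mat_transpose_mult_self_nonneg[of ?X] trace_mat_transpose_mult_self_nonneg[of ?V]
      by linarith+
    then have X0: "?X = 0\<^sub>m p p" and V0: "?V = 0\<^sub>m (n - p) p"
      using trace_mat_transpose_mult_self_eq_0 X' V by blast+
    have "E = ?B"
    proof (rule eq_matI)
      fix i j assume "i < dim_row ?B" "j < dim_col ?B"
      then show "E $$ (i, j) = ?B $$ (i, j)"
        using arg_cong[OF X0, of "\<lambda>M. M $$ (i, j)"] by (simp add: dE)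
    qed (simp_all add: dE)
    moreover have "K = ?C"
    proof (rule eq_matI)
      fix i j assume "i < dim_row ?C" "j < dim_col ?C"
      then show "K $$ (i, j) = ?C $$ (i, j)"
        using arg_cong[OF V0, of "\<lambda>M. M $$ (i, j)"] by (simp add: dE d del: index_mult_mat(1))
    qed (simp_all add: dE d)
    ultimately show "\<zeta> = Y * ?B + Yp * ?C" unfolding eq by simp
  qed
qed

end

section \<open>The Hessian of the objective, one matrix \<open>A l\<close> at a time\<close>

context stiefel_point
begin

text \<open>The contribution of a single \<open>A l\<close> to \<open>hess_form\<close> with the
  factor -4 removed.\<close>

definition hess_summand :: "real mat \<Rightarrow> real mat \<Rightarrow> real mat" where
  "hess_summand A \<xi> = (let d = diag_part (Y\<^sup>T * A * Y); g = A * Y * d in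
     A * \<xi> * d + 2 \<cdot>\<^sub>m (A * Y * diag_part (Y\<^sup>T * A * \<xi>))
     + (1/2) \<cdot>\<^sub>m (Y * \<xi>\<^sup>T * g + g * \<xi>\<^sup>T * Y
                 - (1\<^sub>m n - Y * Y\<^sup>T) * \<xi> * (Y\<^sup>T * g + g\<^sup>T * Y)))"

lemma hess_summand_carrier:
  assumes "A \<in> carrier_mat n n" "\<xi> \<in> carrier_mat n p"
  shows "hess_summand A \<xi> \<in> carrier_mat n p"
  using assms by (auto simp: hess_summand_def Let_def intro!: carrier_matI)

text \<open>The correction terms of \<open>hess_form\<close> are linear in the gradient, so the sum
  over l and the factor -4 can be pulled out of the whole expression.\<close>

lemma hess_form_objective:
  assumes A: "\<And>l. l \<in> {1..N} \<Longrightarrow> A l \<in> carrier_mat n n"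
    and sym: "\<And>l. l \<in> {1..N} \<Longrightarrow> (A l)\<^sup>T = A l"
    and \<xi>: "\<xi> \<in> carrier_mat n p"
  shows "hess_form p n (objective N A) Y \<xi>
    = mat_sum n p (\<lambda>l. (-4) \<cdot>\<^sub>m hess_summand (A l) \<xi>) {1..N}"
proof -
  have d: "dim_row \<xi> = n" "dim_col \<xi> = p" using \<xi> by auto
  have dA: "dim_row (A l) = n" "dim_col (A l) = n" if "l \<in> {1..N}" for l using A[OF that] by auto
  define g where "g l = (-4) \<cdot>\<^sub>m (A l * Y * diag_part (Y\<^sup>T * A l * Y))" for l
  have dg: "dim_row (g l) = n" "dim_col (g l) = p" and g: "g l \<in> carrier_mat n p"
    if "l \<in> {1..N}" for l
    using dA[OF that] by (auto simp: g_def intro!: carrier_matI)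
  let ?S = "\<lambda>M. mat_sum n p M {1..N}" and ?T = "\<lambda>M. mat_sum p p M {1..N}"
  have grad: "euclid_grad p n (objective N A) Y = ?S g"
    unfolding g_def using A sym Y by (intro euclid_grad_objective) auto
  have 1: "Y * \<xi>\<^sup>T * ?S g = ?S (\<lambda>l. Y * \<xi>\<^sup>T * g l)"
    by (subst mult_mat_sum) (auto simp: d dg g)
  have 2: "?S g * \<xi>\<^sup>T * Y = ?S (\<lambda>l. g l * (\<xi>\<^sup>T * Y))"
    using mat_sum_mult[of "\<xi>\<^sup>T * Y" p "{1..N}" g n] by (simp add: mult_mat_assoc d g)
  have "(?S g)\<^sup>T * Y = ?T (\<lambda>l. (g l)\<^sup>T * Y)"
    using transpose_mat_sum[of "{1..N}" g n p] mat_sum_mult[of Y n "{1..N}" "\<lambda>l. (g l)\<^sup>T" p]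
    by (simp add: g)
  moreover have "Y\<^sup>T * ?S g = ?T (\<lambda>l. Y\<^sup>T * g l)"
    using mult_mat_sum[of "Y\<^sup>T" n "{1..N}" g p] by (simp add: g)
  ultimately have "Y\<^sup>T * ?S g + (?S g)\<^sup>T * Y = ?T (\<lambda>l. Y\<^sup>T * g l) + ?T (\<lambda>l. (g l)\<^sup>T * Y)"
    by simp
  also have "\<dots> = ?T (\<lambda>l. Y\<^sup>T * g l + (g l)\<^sup>T * Y)"
    by (rule mat_sum_add) (auto simp: dg intro!: carrier_matI)
  finally have 3: "(1\<^sub>m n - Y * Y\<^sup>T) * \<xi> * (Y\<^sup>T * ?S g + (?S g)\<^sup>T * Y)
      = ?S (\<lambda>l. (1\<^sub>m n - Y * Y\<^sup>T) * \<xi> * (Y\<^sup>T * g l + (g l)\<^sup>T * Y))"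
    by (simp only:, subst mult_mat_sum) (auto simp: d dg intro!: carrier_matI)
  let ?h = "\<lambda>l. Y * \<xi>\<^sup>T * g l + g l * (\<xi>\<^sup>T * Y)
       - (1\<^sub>m n - Y * Y\<^sup>T) * \<xi> * (Y\<^sup>T * g l + (g l)\<^sup>T * Y)"
  have "Y * \<xi>\<^sup>T * ?S g + ?S g * \<xi>\<^sup>T * Y
      - (1\<^sub>m n - Y * Y\<^sup>T) * \<xi> * (Y\<^sup>T * ?S g + (?S g)\<^sup>T * Y) = ?S ?h"
    unfolding 1 2 3
    by (subst mat_sum_add mat_sum_minus, (auto simp: d dg intro!: carrier_matI)[1])+ simp
  then have "hess_form p n (objective N A) Y \<xi> =
     ?S (\<lambda>l. (-4) \<cdot>\<^sub>m (A l * \<xi> * diag_part (Y\<^sup>T * A l * Y)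
       + 2 \<cdot>\<^sub>m (A l * Y * diag_part (Y\<^sup>T * A l * \<xi>)))) + (1/2) \<cdot>\<^sub>m ?S ?h"
    unfolding hess_form_def Let_def grad
    by (subst dir_deriv_euclid_grad_objective) (use A sym Y \<xi> in auto)
  also have "\<dots> = ?S (\<lambda>l. (-4) \<cdot>\<^sub>m (A l * \<xi> * diag_part (Y\<^sup>T * A l * Y)
       + 2 \<cdot>\<^sub>m (A l * Y * diag_part (Y\<^sup>T * A l * \<xi>))) + (1/2) \<cdot>\<^sub>m ?h l)"
    by (subst smult_mat_sum, (auto simp: d dg intro!: carrier_matI)[1],
        rule mat_sum_add, auto simp: d dg intro!: carrier_matI)
  also have "\<dots> = ?S (\<lambda>l. (-4) \<cdot>\<^sub>m hess_summand (A l) \<xi>)"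
  proof (rule mat_sum_cong)
    fix l assume l: "l \<in> {1..N}"
    show "(-4) \<cdot>\<^sub>m (A l * \<xi> * diag_part (Y\<^sup>T * A l * Y)
       + 2 \<cdot>\<^sub>m (A l * Y * diag_part (Y\<^sup>T * A l * \<xi>))) + (1/2) \<cdot>\<^sub>m ?h l
       = (-4) \<cdot>\<^sub>m hess_summand (A l) \<xi>"
      unfolding hess_summand_def Let_def g_def
      by (intro eq_matI)
         (simp_all add: mat_expand d dA[OF l] field_simps del: index_mult_mat(1))
  qed
  finally show ?thesis .
qed

context
  fixes A B C :: "real mat"
  assumes A: "A \<in> carrier_mat n n" and sym: "A\<^sup>T = A"
    and B: "B \<in> skew_mats p" and C: "C \<in> carrier_mat (n - p) p"
begin

lemma summand_dims:
  "dim_row A = n" "dim_col A = n" "dim_row B = p" "dim_col B = p"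
  "dim_row C = n - p" "dim_col C = p" "B\<^sup>T = (-1) \<cdot>\<^sub>m B"
  using A B C by (auto simp: skew_mats_iff)

text \<open>Stated for right-nested products, the form in which the simplifier meets the term after
  \<open>mat_expand\<close>.\<close>

lemma diag_part_decomp:
  "diag_part (Y\<^sup>T * (A * (Y * B)) + Y\<^sup>T * (A * (Yp * C)))
   = diag_part (Y\<^sup>T * (A * (Y * B))) + diag_part (Y\<^sup>T * (A * (Yp * C)))"
  by (rule diag_part_add) (simp_all add: summand_dims)

text \<open>Here the representative \<open>R\<close> replaces \<open>W\<close>. The projector I - Y
  Y^T is killed by Y^T; the remaining discrepancy consists of -1/2 Z d B and 1/2 C^T Zp^T d,
  exchanged for minus their transposes. The first line of \<open>R\<close> is the B-part belonging
  to \<open>H11\<close>, the second the C-part belonging to \<open>H12\<close>.\<close>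

lemma hess_summand_skew:
  fixes W
  defines "W \<equiv> Y\<^sup>T * hess_summand A (Y * B + Yp * C)"
    and "Z \<equiv> Y\<^sup>T * A * Y" and "Zp \<equiv> Y\<^sup>T * A * Yp"
  defines "R \<equiv> Z * B * diag_part Z + 2 \<cdot>\<^sub>m (Z * diag_part (Z * B)) - B * sym_part (Z * diag_part Z)
      + (Zp * C * diag_part Z + 2 \<cdot>\<^sub>m (Z * diag_part (Zp * C)) - (1/2) \<cdot>\<^sub>m (diag_part Z * Zp * C))"
  shows "W - W\<^sup>T = R - R\<^sup>T"
  \<comment> \<open>Entries of the expanded products are left unevaluated, so equality of entries
    becomes a linear identity between them.\<close>
  unfolding W_def R_def Z_def Zp_def hess_summand_def Let_def sym_part_def
  by (intro eq_matI)
     (simp_all add: mat_expand orth summand_dims sym transpose_diag_part diag_part_decomp field_simps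
       del: index_mult_mat(1))

text \<open>Yp^T annihilates the term starting with \<open>Y\<close> and turns (I - Y Y^T) (Y B + Yp
  C) into C. The surviving corrections are -1/2 Zp^T d B, from Y^T Y = I and skewness of
  \<open>B\<close>, and -C sym(Z d).\<close>

lemma hess_summand_normal:
  defines "Z \<equiv> Y\<^sup>T * A * Y" and "Zp \<equiv> Y\<^sup>T * A * Yp" and "Zpp \<equiv> Yp\<^sup>T * A * Yp"
  shows "Yp\<^sup>T * hess_summand A (Y * B + Yp * C) =
    Zp\<^sup>T * B * diag_part Z + 2 \<cdot>\<^sub>m (Zp\<^sup>T * diag_part (Z * B)) - (1/2) \<cdot>\<^sub>m (Zp\<^sup>T * diag_part Z * B)
      + (Zpp * C * diag_part Z + 2 \<cdot>\<^sub>m (Zp\<^sup>T * diag_part (Zp * C)) - C * sym_part (Z * diag_part Z))"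
  unfolding Z_def Zp_def Zpp_def hess_summand_def Let_def sym_part_def
  by (intro eq_matI)
     (simp_all add: mat_expand orth summand_dims sym transpose_diag_part diag_part_decomp field_simps
       del: index_mult_mat(1))

end

end

section \<open>The matrix of the Hessian\<close>

text \<open>The common shape of the summands of all four blocks: the first two terms follow one
  pattern, and the third, which varies, is the parameter \<open>S\<close> with its action
  \<open>T\<close>.\<close>

lemma block_summand_mult_vec_cols:
  assumes "Z \<in> carrier_mat p p" "X \<in> carrier_mat c p" "M \<in> carrier_mat r c"
    and "K \<in> carrier_mat r p" "L \<in> carrier_mat p c"
    and "S \<in> carrier_mat (p * r) (p * c)" "T \<in> carrier_mat r p"
    and "S *\<^sub>v vec_cols X = vec_cols T"
  shows "(diag_part Z \<otimes>\<^sub>K M + 2 \<cdot>\<^sub>m ((1\<^sub>m p \<otimes>\<^sub>K K) * Delta_mat p * (1\<^sub>m p \<otimes>\<^sub>K L)) - S) *\<^sub>v vec_cols X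
    = vec_cols (M * X * diag_part Z + 2 \<cdot>\<^sub>m (K * diag_part (L * X)) - T)"
proof -
  have d: "dim_row Z = p" "dim_col Z = p" "dim_row X = c" "dim_col X = p" "dim_row M = r"
    "dim_col M = c" "dim_row K = r" "dim_col K = p" "dim_row L = p" "dim_col L = c"
    "dim_row S = p * r" "dim_col S = p * c" "dim_row T = r" "dim_col T = p"
    using assms by auto
  show ?thesis
    by (simp add: minus_mat_mult_vec add_mat_mult_vec smult_mat_mult_vec kron_mult_vec_cols
        kron_Delta_kron_mult_vec_cols assms(8) vec_cols_add vec_cols_minus vec_cols_smult
        transpose_diag_part d mult.commute[of c p])
qed

lemma kron_one_right_mult_vec_cols:
  assumes "X \<in> carrier_mat r p" "S \<in> carrier_mat p p" "S\<^sup>T = S"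
  shows "(S \<otimes>\<^sub>K 1\<^sub>m r) *\<^sub>v vec_cols X = vec_cols (X * S)"
  using assms by (subst kron_mult_vec_cols) auto

text \<open>The right factor D expands veck(B) to vec(B), so the summands act on \<open>B\<close>
  itself. The left factor is kept, because it is applied only after the B- and C-parts have been
  added.\<close>

lemma H11_mult_veck:
  assumes Z: "\<And>l. l \<in> {1..N} \<Longrightarrow> Z l \<in> carrier_mat p p" and B: "B \<in> skew_mats p"
  shows "H11 p N Z *\<^sub>v veck B = (-4) \<cdot>\<^sub>v ((D_mat p)\<^sup>T *\<^sub>v vec_cols (mat_sum p p (\<lambda>l.
    Z l * B * diag_part (Z l) + 2 \<cdot>\<^sub>m (Z l * diag_part (Z l * B))
      - B * sym_part (Z l * diag_part (Z l))) {1..N}))"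
proof -
  have B': "B \<in> carrier_mat p p" and d: "dim_row B = p" "dim_col B = p"
    using B by (auto simp: skew_mats_def)
  let ?M = "\<lambda>l. diag_part (Z l) \<otimes>\<^sub>K Z l
     + 2 \<cdot>\<^sub>m ((1\<^sub>m p \<otimes>\<^sub>K Z l) * Delta_mat p * (1\<^sub>m p \<otimes>\<^sub>K Z l))
     - sym_part (Z l * diag_part (Z l)) \<otimes>\<^sub>K 1\<^sub>m p"
  let ?K = "\<lambda>l. Z l * B * diag_part (Z l) + 2 \<cdot>\<^sub>m (Z l * diag_part (Z l * B))
      - B * sym_part (Z l * diag_part (Z l))"
  have "mat_sum (p * p) (p * p) ?M {1..N} *\<^sub>v vec_cols B = vec_cols (mat_sum p p ?K {1..N})"
  proof (rule mat_sum_mult_vec_cols)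
    fix l assume "l \<in> {1..N}"
    then have Zl: "Z l \<in> carrier_mat p p" "dim_row (Z l) = p" "dim_col (Z l) = p"
      using Z by auto
    show "?M l \<in> carrier_mat (p * p) (p * p)" "?K l \<in> carrier_mat p p"
      by (auto simp: Zl d intro!: carrier_matI)
    have S: "sym_part (Z l * diag_part (Z l)) \<in> carrier_mat p p"
      "(sym_part (Z l * diag_part (Z l)))\<^sup>T = sym_part (Z l * diag_part (Z l))"
      by (auto simp: Zl transpose_sym_part intro!: carrier_matI)
    show "?M l *\<^sub>v vec_cols B = vec_cols (?K l)"
      by (rule block_summand_mult_vec_cols[OF Zl(1) B' Zl(1) Zl(1) Zl(1)])
         (auto simp: Zl d kron_one_right_mult_vec_cols[OF B' S] intro!: carrier_matI)
  qed (simp_all add: d)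
  then show ?thesis
    unfolding H11_def
    by (simp add: smult_mat_mult_vec mat_mult_vec_assoc D_mat_mult_veck[OF B] d)
qed

lemma H12_mult_vec_cols:
  assumes Z: "\<And>l. l \<in> {1..N} \<Longrightarrow> Z l \<in> carrier_mat p p"
    and Zp: "\<And>l. l \<in> {1..N} \<Longrightarrow> Zp l \<in> carrier_mat p q" and C: "C \<in> carrier_mat q p"
  shows "H12 p q N Z Zp *\<^sub>v vec_cols C = (-4) \<cdot>\<^sub>v ((D_mat p)\<^sup>T *\<^sub>v vec_cols (mat_sum p p (\<lambda>l.
    Zp l * C * diag_part (Z l) + 2 \<cdot>\<^sub>m (Z l * diag_part (Zp l * C))
      - (1/2) \<cdot>\<^sub>m (diag_part (Z l) * Zp l * C)) {1..N}))"
proof -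
  have d: "dim_row C = q" "dim_col C = p" using C by auto
  let ?M = "\<lambda>l. diag_part (Z l) \<otimes>\<^sub>K Zp l
     + 2 \<cdot>\<^sub>m ((1\<^sub>m p \<otimes>\<^sub>K Z l) * Delta_mat p * (1\<^sub>m p \<otimes>\<^sub>K Zp l))
     - (1/2) \<cdot>\<^sub>m (1\<^sub>m p \<otimes>\<^sub>K (diag_part (Z l) * Zp l))"
  let ?K = "\<lambda>l. Zp l * C * diag_part (Z l) + 2 \<cdot>\<^sub>m (Z l * diag_part (Zp l * C))
      - (1/2) \<cdot>\<^sub>m (diag_part (Z l) * Zp l * C)"
  have "mat_sum (p * p) (p * q) ?M {1..N} *\<^sub>v vec_cols C = vec_cols (mat_sum p p ?K {1..N})"
  proof (rule mat_sum_mult_vec_cols)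
    fix l assume l: "l \<in> {1..N}"
    have Zl: "Z l \<in> carrier_mat p p" "dim_row (Z l) = p" "dim_col (Z l) = p"
      and Zpl: "Zp l \<in> carrier_mat p q" "dim_row (Zp l) = p" "dim_col (Zp l) = q"
      using Z[OF l] Zp[OF l] by auto
    show "?M l \<in> carrier_mat (p * p) (p * q)" "?K l \<in> carrier_mat p p"
      by (auto simp: Zl Zpl d intro!: carrier_matI)
    show "?M l *\<^sub>v vec_cols C = vec_cols (?K l)"
      by (rule block_summand_mult_vec_cols[OF Zl(1) C Zpl(1) Zl(1) Zpl(1)])
         (auto simp: Zl Zpl d smult_mat_mult_vec kron_one_left_mult_vec_cols vec_cols_smult
           mult.commute intro!: carrier_matI)
  qed (simp_all add: d mult.commute)
  then show ?thesis
    unfolding H12_def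
    by (simp add: smult_mat_mult_vec mat_mult_vec_assoc d mult.commute)
qed

lemma H21_mult_veck:
  assumes Z: "\<And>l. l \<in> {1..N} \<Longrightarrow> Z l \<in> carrier_mat p p"
    and Zp: "\<And>l. l \<in> {1..N} \<Longrightarrow> Zp l \<in> carrier_mat p q" and B: "B \<in> skew_mats p"
  shows "H21 p q N Z Zp *\<^sub>v veck B = (-4) \<cdot>\<^sub>v vec_cols (mat_sum q p (\<lambda>l.
    (Zp l)\<^sup>T * B * diag_part (Z l) + 2 \<cdot>\<^sub>m ((Zp l)\<^sup>T * diag_part (Z l * B))
      - (1/2) \<cdot>\<^sub>m ((Zp l)\<^sup>T * diag_part (Z l) * B)) {1..N})"
proof -
  have B': "B \<in> carrier_mat p p" and d: "dim_row B = p" "dim_col B = p"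
    using B by (auto simp: skew_mats_def)
  let ?M = "\<lambda>l. diag_part (Z l) \<otimes>\<^sub>K (Zp l)\<^sup>T
     + 2 \<cdot>\<^sub>m ((1\<^sub>m p \<otimes>\<^sub>K (Zp l)\<^sup>T) * Delta_mat p * (1\<^sub>m p \<otimes>\<^sub>K Z l))
     - (1/2) \<cdot>\<^sub>m (1\<^sub>m p \<otimes>\<^sub>K ((Zp l)\<^sup>T * diag_part (Z l)))"
  let ?K = "\<lambda>l. (Zp l)\<^sup>T * B * diag_part (Z l) + 2 \<cdot>\<^sub>m ((Zp l)\<^sup>T * diag_part (Z l * B))
      - (1/2) \<cdot>\<^sub>m ((Zp l)\<^sup>T * diag_part (Z l) * B)"
  have "mat_sum (p * q) (p * p) ?M {1..N} *\<^sub>v vec_cols B = vec_cols (mat_sum q p ?K {1..N})"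
  proof (rule mat_sum_mult_vec_cols)
    fix l assume l: "l \<in> {1..N}"
    have Zl: "Z l \<in> carrier_mat p p" "dim_row (Z l) = p" "dim_col (Z l) = p"
      and Zpl: "(Zp l)\<^sup>T \<in> carrier_mat q p" "dim_row (Zp l) = p" "dim_col (Zp l) = q"
      using Z[OF l] Zp[OF l] by auto
    show "?M l \<in> carrier_mat (p * q) (p * p)" "?K l \<in> carrier_mat q p"
      by (auto simp: Zl Zpl d intro!: carrier_matI)
    show "?M l *\<^sub>v vec_cols B = vec_cols (?K l)"
      by (rule block_summand_mult_vec_cols[OF Zl(1) B' Zpl(1) Zpl(1) Zl(1)])
         (auto simp: Zl Zpl d smult_mat_mult_vec kron_one_left_mult_vec_cols vec_cols_smult
           mult.commute intro!: carrier_matI)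
  qed (simp_all add: d mult.commute)
  then show ?thesis
    unfolding H21_def
    by (simp add: smult_mat_mult_vec mat_mult_vec_assoc D_mat_mult_veck[OF B] d)
qed

lemma H22_mult_vec_cols:
  assumes Z: "\<And>l. l \<in> {1..N} \<Longrightarrow> Z l \<in> carrier_mat p p"
    and Zp: "\<And>l. l \<in> {1..N} \<Longrightarrow> Zp l \<in> carrier_mat p q"
    and Zpp: "\<And>l. l \<in> {1..N} \<Longrightarrow> Zpp l \<in> carrier_mat q q" and C: "C \<in> carrier_mat q p"
  shows "H22 p q N Z Zp Zpp *\<^sub>v vec_cols C = (-4) \<cdot>\<^sub>v vec_cols (mat_sum q p (\<lambda>l.
    Zpp l * C * diag_part (Z l) + 2 \<cdot>\<^sub>m ((Zp l)\<^sup>T * diag_part (Zp l * C))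
      - C * sym_part (Z l * diag_part (Z l))) {1..N})"
proof -
  have d: "dim_row C = q" "dim_col C = p" using C by auto
  let ?M = "\<lambda>l. diag_part (Z l) \<otimes>\<^sub>K Zpp l
     + 2 \<cdot>\<^sub>m ((1\<^sub>m p \<otimes>\<^sub>K (Zp l)\<^sup>T) * Delta_mat p * (1\<^sub>m p \<otimes>\<^sub>K Zp l))
     - sym_part (Z l * diag_part (Z l)) \<otimes>\<^sub>K 1\<^sub>m q"
  let ?K = "\<lambda>l. Zpp l * C * diag_part (Z l) + 2 \<cdot>\<^sub>m ((Zp l)\<^sup>T * diag_part (Zp l * C))
      - C * sym_part (Z l * diag_part (Z l))"
  have "mat_sum (p * q) (p * q) ?M {1..N} *\<^sub>v vec_cols C = vec_cols (mat_sum q p ?K {1..N})"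
  proof (rule mat_sum_mult_vec_cols)
    fix l assume l: "l \<in> {1..N}"
    have Zl: "Z l \<in> carrier_mat p p" "dim_row (Z l) = p" "dim_col (Z l) = p"
      and Zpl: "Zp l \<in> carrier_mat p q" "dim_row (Zp l) = p" "dim_col (Zp l) = q"
        "(Zp l)\<^sup>T \<in> carrier_mat q p"
      and Zppl: "Zpp l \<in> carrier_mat q q" "dim_row (Zpp l) = q" "dim_col (Zpp l) = q"
      using Z[OF l] Zp[OF l] Zpp[OF l] by auto
    show "?M l \<in> carrier_mat (p * q) (p * q)" "?K l \<in> carrier_mat q p"
      by (auto simp: Zl Zpl Zppl d intro!: carrier_matI)
    have S: "sym_part (Z l * diag_part (Z l)) \<in> carrier_mat p p"
      "(sym_part (Z l * diag_part (Z l)))\<^sup>T = sym_part (Z l * diag_part (Z l))"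
      by (auto simp: Zl transpose_sym_part intro!: carrier_matI)
    show "?M l *\<^sub>v vec_cols C = vec_cols (?K l)"
      by (rule block_summand_mult_vec_cols[OF Zl(1) C Zppl(1) Zpl(4) Zpl(1)])
         (auto simp: Zl Zpl d kron_one_right_mult_vec_cols[OF C S] intro!: carrier_matI)
  qed (simp_all add: d mult.commute)
  then show ?thesis
    unfolding H22_def by (simp add: smult_mat_mult_vec d mult.commute)
qed

section \<open>Sizes and symmetry of the blocks\<close>

lemma H_block_carriers:
  "H11 p N Z \<in> carrier_mat (p * (p - 1) div 2) (p * (p - 1) div 2)"
  "H12 p q N Z Zp \<in> carrier_mat (p * (p - 1) div 2) (p * q)"
  "H21 p q N Z Zp \<in> carrier_mat (p * q) (p * (p - 1) div 2)"
  "H22 p q N Z Zp Zpp \<in> carrier_mat (p * q) (p * q)"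
  by (auto simp: H11_def H12_def H21_def H22_def intro!: carrier_matI)

text \<open>A congruence by \<open>D_mat\<close> preserves symmetry, and each summand is symmetric:
  the first by symmetry of \<open>Z l\<close>, the second because transposition reverses a
  palindromic product, the third through \<open>sym_part\<close>.\<close>

lemma H11_symmetric:
  assumes Z: "\<And>l. l \<in> {1..N} \<Longrightarrow> Z l \<in> carrier_mat p p"
    and sym: "\<And>l. l \<in> {1..N} \<Longrightarrow> (Z l)\<^sup>T = Z l"
  shows "(H11 p N Z)\<^sup>T = H11 p N Z"
proof -
  let ?M = "\<lambda>l. diag_part (Z l) \<otimes>\<^sub>K Z l
     + 2 \<cdot>\<^sub>m ((1\<^sub>m p \<otimes>\<^sub>K Z l) * Delta_mat p * (1\<^sub>m p \<otimes>\<^sub>K Z l))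
     - sym_part (Z l * diag_part (Z l)) \<otimes>\<^sub>K 1\<^sub>m p"
  let ?S = "mat_sum (p * p) (p * p) ?M {1..N}"
  have d: "dim_row (Z l) = p" "dim_col (Z l) = p" if "l \<in> {1..N}" for l using Z[OF that] by auto
  have "?S\<^sup>T = mat_sum (p * p) (p * p) (\<lambda>l. (?M l)\<^sup>T) {1..N}"
    by (rule transpose_mat_sum) (auto simp: d intro!: carrier_matI)
  also have "\<dots> = ?S"
    by (rule mat_sum_cong)
       (simp add: mat_expand transpose_kron transpose_diag_part transpose_sym_part
         transpose_Delta_mat sym d)
  finally have "?S\<^sup>T = ?S" .
  then show ?thesis unfolding H11_def by (simp add: mat_expand)
qed

text \<open>Transposition reverses the product around Delta and turns diag(Z) Zp into Zp^T diag(Z),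
  which matches the summands of \<open>H21\<close> one by one.\<close>

lemma H12_transpose:
  assumes Z: "\<And>l. l \<in> {1..N} \<Longrightarrow> Z l \<in> carrier_mat p p"
    and sym: "\<And>l. l \<in> {1..N} \<Longrightarrow> (Z l)\<^sup>T = Z l"
    and Zp: "\<And>l. l \<in> {1..N} \<Longrightarrow> Zp l \<in> carrier_mat p q"
  shows "(H12 p q N Z Zp)\<^sup>T = H21 p q N Z Zp"
proof -
  let ?M = "\<lambda>l. diag_part (Z l) \<otimes>\<^sub>K Zp l
     + 2 \<cdot>\<^sub>m ((1\<^sub>m p \<otimes>\<^sub>K Z l) * Delta_mat p * (1\<^sub>m p \<otimes>\<^sub>K Zp l))
     - (1/2) \<cdot>\<^sub>m (1\<^sub>m p \<otimes>\<^sub>K (diag_part (Z l) * Zp l))"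
  let ?M' = "\<lambda>l. diag_part (Z l) \<otimes>\<^sub>K (Zp l)\<^sup>T
     + 2 \<cdot>\<^sub>m ((1\<^sub>m p \<otimes>\<^sub>K (Zp l)\<^sup>T) * Delta_mat p * (1\<^sub>m p \<otimes>\<^sub>K Z l))
     - (1/2) \<cdot>\<^sub>m (1\<^sub>m p \<otimes>\<^sub>K ((Zp l)\<^sup>T * diag_part (Z l)))"
  have d: "dim_row (Z l) = p" "dim_col (Z l) = p" "dim_row (Zp l) = p" "dim_col (Zp l) = q"
    if "l \<in> {1..N}" for l using Z[OF that] Zp[OF that] by auto
  have "(mat_sum (p * p) (p * q) ?M {1..N})\<^sup>T = mat_sum (p * q) (p * p) (\<lambda>l. (?M l)\<^sup>T) {1..N}"
    by (rule transpose_mat_sum) (auto simp: d intro!: carrier_matI)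
  also have "\<dots> = mat_sum (p * q) (p * p) ?M' {1..N}"
    by (rule mat_sum_cong)
       (simp add: mat_expand transpose_kron transpose_diag_part transpose_Delta_mat sym d)
  finally show ?thesis unfolding H12_def H21_def by (simp add: mat_expand)
qed

lemma H22_symmetric:
  assumes Z: "\<And>l. l \<in> {1..N} \<Longrightarrow> Z l \<in> carrier_mat p p"
    and Zp: "\<And>l. l \<in> {1..N} \<Longrightarrow> Zp l \<in> carrier_mat p q"
    and Zpp: "\<And>l. l \<in> {1..N} \<Longrightarrow> Zpp l \<in> carrier_mat q q"
    and sym: "\<And>l. l \<in> {1..N} \<Longrightarrow> (Zpp l)\<^sup>T = Zpp l"
  shows "(H22 p q N Z Zp Zpp)\<^sup>T = H22 p q N Z Zp Zpp"
proof -
  let ?M = "\<lambda>l. diag_part (Z l) \<otimes>\<^sub>K Zpp l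
     + 2 \<cdot>\<^sub>m ((1\<^sub>m p \<otimes>\<^sub>K (Zp l)\<^sup>T) * Delta_mat p * (1\<^sub>m p \<otimes>\<^sub>K Zp l))
     - sym_part (Z l * diag_part (Z l)) \<otimes>\<^sub>K 1\<^sub>m q"
  let ?S = "mat_sum (p * q) (p * q) ?M {1..N}"
  have d: "dim_row (Z l) = p" "dim_col (Z l) = p" "dim_row (Zp l) = p" "dim_col (Zp l) = q"
    "dim_row (Zpp l) = q" "dim_col (Zpp l) = q"
    if "l \<in> {1..N}" for l using Z[OF that] Zp[OF that] Zpp[OF that] by auto
  have "?S\<^sup>T = mat_sum (p * q) (p * q) (\<lambda>l. (?M l)\<^sup>T) {1..N}"
    by (rule transpose_mat_sum) (auto simp: d intro!: carrier_matI)
  also have "\<dots> = ?S"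
    by (rule mat_sum_cong)
       (simp add: mat_expand transpose_kron transpose_diag_part transpose_sym_part
         transpose_Delta_mat sym d)
  finally have "?S\<^sup>T = ?S" .
  then show ?thesis unfolding H22_def by (simp add: transpose_smult_mat)
qed

section \<open>Assembly of the coordinates of the Hessian\<close>

context stiefel_point
begin

lemma canonical_hess_objective:
  assumes A: "\<And>l. l \<in> {1..N} \<Longrightarrow> A l \<in> carrier_mat n n"
    and sym: "\<And>l. l \<in> {1..N} \<Longrightarrow> (A l)\<^sup>T = A l"
    and B: "B \<in> skew_mats p" and C: "C \<in> carrier_mat (n - p) p"
  defines "Z \<equiv> \<lambda>l. Y\<^sup>T * A l * Y" and "Zp \<equiv> \<lambda>l. Y\<^sup>T * A l * Yp" and "Zpp \<equiv> \<lambda>l. Yp\<^sup>T * A l * Yp"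
  obtains BH CH where "BH \<in> skew_mats p" "CH \<in> carrier_mat (n - p) p"
    "canonical_hess p n (objective N A) Y (Y * B + Yp * C) = Y * BH + Yp * CH"
    "veck BH @\<^sub>v vec_cols CH = H_mat p (n - p) N Z Zp Zpp *\<^sub>v (veck B @\<^sub>v vec_cols C)"
proof -
  let ?q = "n - p" and ?\<xi> = "Y * B + Yp * C"
  have dB: "dim_row B = p" "dim_col B = p" and dC: "dim_row C = n - p" "dim_col C = p"
    using B C by (auto simp: skew_mats_def)
  have xi: "?\<xi> \<in> carrier_mat n p" by (intro carrier_matI) (simp_all add: dB dC)
  have dA: "dim_row (A l) = n" "dim_col (A l) = n" if "l \<in> {1..N}" for l using A[OF that] by auto
  have Z: "Z l \<in> carrier_mat p p" and Zp: "Zp l \<in> carrier_mat p ?q" and Zpp: "Zpp l \<in> carrier_mat ?q ?q"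
    for l by (auto simp: Z_def Zp_def Zpp_def intro!: carrier_matI)
  have dZ: "dim_row (Z l) = p" "dim_col (Z l) = p" "dim_row (Zp l) = p" "dim_col (Zp l) = ?q"
    "dim_row (Zpp l) = ?q" "dim_col (Zpp l) = ?q" for l
    by (auto simp: Z_def Zp_def Zpp_def)
  define G where "G = hess_form p n (objective N A) Y ?\<xi>"
  have G: "G = mat_sum n p (\<lambda>l. (-4) \<cdot>\<^sub>m hess_summand (A l) ?\<xi>) {1..N}"
    unfolding G_def by (rule hess_form_objective[OF A sym xi])
  have dG: "dim_row (hess_summand (A l) ?\<xi>) = n" "dim_col (hess_summand (A l) ?\<xi>) = p"
    if "l \<in> {1..N}" for l using hess_summand_carrier[OF A[OF that] xi] by auto
  have Gc: "G \<in> carrier_mat n p" unfolding G by simp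
  define R1 where "R1 l = Z l * B * diag_part (Z l) + 2 \<cdot>\<^sub>m (Z l * diag_part (Z l * B))
      - B * sym_part (Z l * diag_part (Z l))" for l
  define R2 where "R2 l = Zp l * C * diag_part (Z l) + 2 \<cdot>\<^sub>m (Z l * diag_part (Zp l * C))
      - (1/2) \<cdot>\<^sub>m (diag_part (Z l) * Zp l * C)" for l
  define S1 where "S1 l = (Zp l)\<^sup>T * B * diag_part (Z l) + 2 \<cdot>\<^sub>m ((Zp l)\<^sup>T * diag_part (Z l * B))
      - (1/2) \<cdot>\<^sub>m ((Zp l)\<^sup>T * diag_part (Z l) * B)" for l
  define S2 where "S2 l = Zpp l * C * diag_part (Z l) + 2 \<cdot>\<^sub>m ((Zp l)\<^sup>T * diag_part (Zp l * C))
      - C * sym_part (Z l * diag_part (Z l))" for l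
  have R: "R1 l \<in> carrier_mat p p" "R2 l \<in> carrier_mat p p"
    and S: "S1 l \<in> carrier_mat ?q p" "S2 l \<in> carrier_mat ?q p" for l
    by (auto simp: R1_def R2_def S1_def S2_def dZ dB dC intro!: carrier_matI)
  have dR: "dim_row (R1 l) = p" "dim_col (R1 l) = p" "dim_row (R2 l) = p" "dim_col (R2 l) = p" for l
    using R[of l] by auto
  define W where "W = Y\<^sup>T * G"
  define BH where "BH = W - W\<^sup>T"
  define CH where "CH = Yp\<^sup>T * G"
  have hess: "canonical_hess p n (objective N A) Y ?\<xi> = Y * BH + Yp * CH" "BH \<in> skew_mats p"
    unfolding BH_def CH_def W_def G_def
    using canonical_hess_eqI[of "objective N A" ?\<xi>] Gc by (simp_all add: G_def)
  have CHc: "CH \<in> carrier_mat ?q p" unfolding CH_def G by (intro carrier_matI) simp_all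
  have CH: "CH = (-4) \<cdot>\<^sub>m (mat_sum ?q p S1 {1..N} + mat_sum ?q p S2 {1..N})"
  proof -
    have "CH = mat_sum ?q p (\<lambda>l. Yp\<^sup>T * ((-4) \<cdot>\<^sub>m hess_summand (A l) ?\<xi>)) {1..N}"
      unfolding CH_def G by (subst mult_mat_sum) (auto simp: dG intro!: carrier_matI)
    also have "\<dots> = mat_sum ?q p (\<lambda>l. (-4) \<cdot>\<^sub>m (S1 l + S2 l)) {1..N}"
      by (rule mat_sum_cong)
         (simp add: mult_mat_smult dG hess_summand_normal[OF A sym B C] S1_def S2_def Z_def Zp_def Zpp_def)
    also have "\<dots> = (-4) \<cdot>\<^sub>m (mat_sum ?q p S1 {1..N} + mat_sum ?q p S2 {1..N})"
      using S by (simp add: mat_sum_add smult_mat_sum)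
    finally show ?thesis .
  qed
  \<comment> \<open>The representative of W modulo symmetric matrices that the upper blocks produce.
    W and X give the same \<open>BH\<close>, and veck(X - X^T) is D^T vec(X).\<close>
  define X where "X = (-4) \<cdot>\<^sub>m (mat_sum p p R1 {1..N} + mat_sum p p R2 {1..N})"
  have X: "X = mat_sum p p (\<lambda>l. (-4) \<cdot>\<^sub>m (R1 l + R2 l)) {1..N}"
    unfolding X_def using R by (simp add: mat_sum_add smult_mat_sum)
  have BH: "BH = X - X\<^sup>T"
  proof -
    let ?W = "\<lambda>l. Y\<^sup>T * hess_summand (A l) ?\<xi>"
    have W: "W = mat_sum p p (\<lambda>l. (-4) \<cdot>\<^sub>m ?W l) {1..N}"
      unfolding W_def G
      by (subst mult_mat_sum) (auto simp: dG mult_mat_smult intro!: carrier_matI mat_sum_cong)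
    have "BH = mat_sum p p (\<lambda>l. (-4) \<cdot>\<^sub>m (?W l - (?W l)\<^sup>T)) {1..N}"
      unfolding BH_def W
      by (subst transpose_mat_sum, (auto simp: dG intro!: carrier_matI)[1],
          subst mat_sum_minus, (auto simp: dG intro!: carrier_matI)[1],
          rule mat_sum_cong, simp add: smult_minus_mat transpose_smult_mat dG)
    also have "\<dots> = mat_sum p p (\<lambda>l. (-4) \<cdot>\<^sub>m (R1 l + R2 l - (R1 l + R2 l)\<^sup>T)) {1..N}"
      by (rule mat_sum_cong)
         (simp only: hess_summand_skew[OF A sym B C] R1_def R2_def Z_def Zp_def)
    also have "\<dots> = X - X\<^sup>T"
      unfolding X
      by (subst transpose_mat_sum, (auto simp: dR intro!: carrier_matI)[1],
          subst mat_sum_minus, (auto simp: dR intro!: carrier_matI)[1],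
          rule mat_sum_cong, simp add: smult_minus_mat transpose_smult_mat dR)
    finally show ?thesis .
  qed
  have Xc: "X \<in> carrier_mat p p" unfolding X by simp
  have sum_vec: "(-4) \<cdot>\<^sub>v u + (-4) \<cdot>\<^sub>v v = (-4) \<cdot>\<^sub>v (u + v)" if "dim_vec u = dim_vec v" for u v :: "real vec"
    using that by (intro eq_vecI) auto
  have "veck BH = (D_mat p)\<^sup>T *\<^sub>v vec_cols X"
    unfolding BH by (rule D_mat_transpose_mult[OF Xc, symmetric])
  also have "\<dots> = H11 p N Z *\<^sub>v veck B + H12 p ?q N Z Zp *\<^sub>v vec_cols C"
    unfolding H11_mult_veck[OF Z B] H12_mult_vec_cols[OF Z Zp C] R1_def[symmetric] R2_def[symmetric] X_def
    by (subst sum_vec)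
       (simp_all add: vec_cols_smult vec_cols_add mult_mat_vec_add mult_mat_vec_smult)
  finally have veck: "veck BH = H11 p N Z *\<^sub>v veck B + H12 p ?q N Z Zp *\<^sub>v vec_cols C" .
  have vec: "vec_cols CH = H21 p ?q N Z Zp *\<^sub>v veck B + H22 p ?q N Z Zp Zpp *\<^sub>v vec_cols C"
    unfolding H21_mult_veck[OF Z Zp B] H22_mult_vec_cols[OF Z Zp Zpp C] S1_def[symmetric] S2_def[symmetric] CH
    by (subst sum_vec) (simp_all add: vec_cols_smult vec_cols_add)
  have "H_mat p ?q N Z Zp Zpp *\<^sub>v (veck B @\<^sub>v vec_cols C) = veck BH @\<^sub>v vec_cols CH"
    unfolding H_mat_def veck vec
    by (rule four_block_mat_mult_vec[OF H_block_carriers]) (simp_all add: carrier_vecI dB dC)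
  then show ?thesis using hess CHc by (intro that) simp_all
qed

end

theorem mainTheorem3:
  fixes n p N :: nat and A Z Zp Zpp :: "nat \<Rightarrow> real mat" and Y Yp :: "real mat"
  assumes "1 \<le> p" and "p \<le> n"
    and "\<And>l. l \<in> {1..N} \<Longrightarrow> A l \<in> carrier_mat n n"
    and "\<And>l. l \<in> {1..N} \<Longrightarrow> (A l)\<^sup>T = A l"
    and "Y \<in> stiefel p n"
    and "Yp \<in> carrier_mat n (n - p)"
    and "Y\<^sup>T * Yp = 0\<^sub>m p (n - p)"
    and "Yp\<^sup>T * Yp = 1\<^sub>m (n - p)"
    and "Z = (\<lambda>l. Y\<^sup>T * A l * Y)"
    and "Zp = (\<lambda>l. Y\<^sup>T * A l * Yp)"
    and "Zpp = (\<lambda>l. Yp\<^sup>T * A l * Yp)"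
  shows
    "(\<forall>B\<in>skew_mats p. \<forall>C\<in>carrier_mat (n - p) p.
       (\<exists>BH\<in>skew_mats p. \<exists>CH\<in>carrier_mat (n - p) p.
          canonical_hess p n (objective N A) Y (Y * B + Yp * C) = Y * BH + Yp * CH) \<and>
       (\<forall>BH\<in>skew_mats p. \<forall>CH\<in>carrier_mat (n - p) p.
          canonical_hess p n (objective N A) Y (Y * B + Yp * C) = Y * BH + Yp * CH \<longrightarrow>
          veck BH @\<^sub>v vec_cols CH = H_mat p (n - p) N Z Zp Zpp *\<^sub>v (veck B @\<^sub>v vec_cols C))) \<and>
     (H_mat p (n - p) N Z Zp Zpp)\<^sup>T = H_mat p (n - p) N Z Zp Zpp \<and>
     (H11 p N Z)\<^sup>T = H11 p N Z \<and>
     (H12 p (n - p) N Z Zp)\<^sup>T = H21 p (n - p) N Z Zp \<and>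
     (H22 p (n - p) N Z Zp Zpp)\<^sup>T = H22 p (n - p) N Z Zp Zpp"
proof -
  interpret stiefel_point n p Y Yp
    using assms(2,5-8) by unfold_locales (auto simp: stiefel_def)
  have dA: "dim_row (A l) = n" "dim_col (A l) = n" if "l \<in> {1..N}" for l
    using assms(3)[OF that] by auto
  have Z: "Z l \<in> carrier_mat p p" and Zp: "Zp l \<in> carrier_mat p (n - p)"
    and Zpp: "Zpp l \<in> carrier_mat (n - p) (n - p)" for l
    by (auto simp: assms(9-11) intro!: carrier_matI)
  have ZT: "(Z l)\<^sup>T = Z l" and ZppT: "(Zpp l)\<^sup>T = Zpp l" if "l \<in> {1..N}" for l
    by (simp_all add: assms(9-11) mat_expand dA[OF that] assms(4)[OF that])
  have sym: "(H11 p N Z)\<^sup>T = H11 p N Z" "(H12 p (n - p) N Z Zp)\<^sup>T = H21 p (n - p) N Z Zp"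
    "(H22 p (n - p) N Z Zp Zpp)\<^sup>T = H22 p (n - p) N Z Zp Zpp"
    by (rule H11_symmetric[OF Z ZT] H12_transpose[OF Z ZT Zp] H22_symmetric[OF Z Zp Zpp ZppT]; assumption)+
  have "(H_mat p (n - p) N Z Zp Zpp)\<^sup>T = H_mat p (n - p) N Z Zp Zpp"
    unfolding H_mat_def by (rule four_block_symmetric[OF H_block_carriers sym])
  moreover have "(\<exists>BH\<in>skew_mats p. \<exists>CH\<in>carrier_mat (n - p) p.
          canonical_hess p n (objective N A) Y (Y * B + Yp * C) = Y * BH + Yp * CH) \<and>
       (\<forall>BH\<in>skew_mats p. \<forall>CH\<in>carrier_mat (n - p) p.
          canonical_hess p n (objective N A) Y (Y * B + Yp * C) = Y * BH + Yp * CH \<longrightarrow>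
          veck BH @\<^sub>v vec_cols CH = H_mat p (n - p) N Z Zp Zpp *\<^sub>v (veck B @\<^sub>v vec_cols C))"
    if B: "B \<in> skew_mats p" and C: "C \<in> carrier_mat (n - p) p" for B C
  proof -
    obtain BH CH where *: "BH \<in> skew_mats p" "CH \<in> carrier_mat (n - p) p"
      "canonical_hess p n (objective N A) Y (Y * B + Yp * C) = Y * BH + Yp * CH"
      "veck BH @\<^sub>v vec_cols CH = H_mat p (n - p) N Z Zp Zpp *\<^sub>v (veck B @\<^sub>v vec_cols C)"
      unfolding assms(9-11)
      by (rule canonical_hess_objective[OF assms(3,4) B C])
    \<comment> \<open>Coordinates are unique, so the equation proved for the constructed pair holds
      for every pair that represents the Hessian.\<close>
    have "BH' = BH" "CH' = CH"
      if "BH' \<in> skew_mats p" "CH' \<in> carrier_mat (n - p) p" "Y * BH' + Yp * CH' = Y * BH + Yp * CH"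
      for BH' CH'
      using decomp_unique[of BH' CH' BH CH] that *(1,2) by (auto simp: skew_mats_def)
    then show ?thesis using * by metis
  qed
  ultimately show ?thesis using sym by blast
qed

end
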